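(* Let $D_0\in\mathcal{H}_\infty$, $D_0(s)=\sum_{n\ge 1}a_n n^{-s}$, and let $M_{D_0}:\mathcal{H}_2\to\mathcal{H}_2$ be the multiplication operator $M_{D_0}D=D_0D$. The following are equivalent. (i) $M_{D_0}$ admits a Parseval frame of orbits, i.e. there exists a countable family $\{D_i\}_{i\in I}\subseteq\mathcal{H}_2$ such that $\{M_{D_0}^n D_i\}_{i\in I,\,n\ge 0}$ is a Parseval frame for $\mathcal{H}_2$. (ii) $M_{D_0}$ admits a frame of orbits, i.e. there exists a countable family $\{D_i\}_{i\in I}\subseteq\mathcal{H}_2$ such that $\{M_{D_0}^n D_i\}_{i\in I,\,n\ge 0}$ is a frame for $\mathcal{H}_2$. (iii) $\|D_0\|_\infty\le 1$ and $|a_1|<1$, where $a_1$ is the constant term of $D_0$. When these equivalent conditions hold, any such frame necessarily has infinitely many orbits (i.e. the index set $I$ is infinite).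
   Context: An ordinary Dirichlet series is a formal sum $D(s)=\sum_{n=1}^\infty a_n n^{-s}$ with complex coefficients $a_n$. $\mathcal{H}_2$ is the Hilbert space of all Dirichlet series with $\sum_{n\ge1}|a_n|^2<\infty$, with norm $\big(\sum_n|a_n|^2\big)^{1/2}$ (so $\{n^{-s}\}_{n\ge1}$ is an orthonormal basis). $\mathcal{H}_\infty$ is the space of Dirichlet series that define a bounded holomorphic function on $\mathbb{C}_+=\{s\in\mathbb{C}:\operatorname{Re}(s)>0\}$, with norm $\|D\|_\infty=\sup_{s\in\mathbb{C}_+}|D(s)|$. The product of two Dirichlet series is the formal product $\big(\sum_n a_n n^{-s}\big)\big(\sum_n b_n n^{-s}\big)=\sum_n\big(\sum_{km=n}a_kb_m\big)n^{-s}$. It is known that $\mathcal{H}_\infty$ is the space of multipliers of $\mathcal{H}_2$, so $M_{D_0}$ is a well-defined bounded operator on $\mathcal{H}_2$ for $D_0\in\mathcal{H}_\infty$. A countable family $\{x_j\}_{j\in\Omega}$ in a Hilbert space $\mathcal{H}$ is a frame for $\mathcal{H}$ if there are constants $A,B>0$ with $A\|y\|^2\le\sum_{j\in\Omega}|\langle y,x_j\rangle|^2\le B\|y\|^2$ for all $y\in\mathcal{H}$; it is a Parseval frame if one can take $A=B=1$. *)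

theory Defs
  imports "HOL-Complex_Analysis.Complex_Analysis"
begin

text \<open>
  A Dirichlet series \<open>\<Sum>n\<ge>1. a n * n powr (-s)\<close> is represented by its coefficient
  function \<open>a :: nat \<Rightarrow> complex\<close>.  There is no coefficient of index \<open>0\<close>; the spaces below
  normalise the junk value by \<open>a 0 = 0\<close>, so that distinct functions in them are distinct series.
\<close>

type_synonym dirichlet_series = "nat \<Rightarrow> complex"

definition dirichlet_prod :: "dirichlet_series \<Rightarrow> dirichlet_series \<Rightarrow> dirichlet_series" where
  "dirichlet_prod a b n = (if n = 0 then 0 else \<Sum>(k, m) | k * m = n. a k * b m)"

text \<open>The term \<open>n = 0\<close> vanishes because \<open>0 powr z = 0\<close>.\<close>

definition dirichlet_sum :: "dirichlet_series \<Rightarrow> complex \<Rightarrow> complex" where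
  "dirichlet_sum a s = (\<Sum>n. a n * of_nat n powr (- s))"

definition right_half_plane :: "complex set" where
  "right_half_plane = {s. Re s > 0}"

definition H2 :: "dirichlet_series set" where
  "H2 = {a. a 0 = 0 \<and> summable (\<lambda>n. (cmod (a n))\<^sup>2)}"

definition H2_inner :: "dirichlet_series \<Rightarrow> dirichlet_series \<Rightarrow> complex" where
  "H2_inner a b = (\<Sum>n. a n * cnj (b n))"

definition H2_norm :: "dirichlet_series \<Rightarrow> real" where
  "H2_norm a = sqrt (\<Sum>n. (cmod (a n))\<^sup>2)"

text \<open>
  The series must converge (possibly conditionally) at every point of the half-plane,
  so that its sum is the function it defines there.
\<close>

definition Hinf :: "dirichlet_series set" where
  "Hinf = {a. a 0 = 0 \<and>
     (\<forall>s\<in>right_half_plane. summable (\<lambda>n. a n * of_nat n powr (- s))) \<and>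
     dirichlet_sum a holomorphic_on right_half_plane \<and>
     bounded (dirichlet_sum a ` right_half_plane)}"

definition Hinf_norm :: "dirichlet_series \<Rightarrow> real" where
  "Hinf_norm a = (SUP s\<in>right_half_plane. cmod (dirichlet_sum a s))"

definition mult_op :: "dirichlet_series \<Rightarrow> dirichlet_series \<Rightarrow> dirichlet_series" where
  "mult_op D0 = (\<lambda>D. dirichlet_prod D0 D)"

text \<open>
  Summability is demanded explicitly because \<open>infsum\<close> is \<open>0\<close> on families that are not summable.
\<close>

definition frame_with_bounds ::
    "real \<Rightarrow> real \<Rightarrow> 'j set \<Rightarrow> ('j \<Rightarrow> dirichlet_series) \<Rightarrow> bool" where
  "frame_with_bounds A B J x \<longleftrightarrow>
     countable J \<and> (\<forall>j\<in>J. x j \<in> H2) \<and>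
     (\<forall>y\<in>H2. (\<lambda>j. (cmod (H2_inner y (x j)))\<^sup>2) summable_on J \<and>
        A * (H2_norm y)\<^sup>2 \<le> (\<Sum>\<^sub>\<infinity>j\<in>J. (cmod (H2_inner y (x j)))\<^sup>2) \<and>
        (\<Sum>\<^sub>\<infinity>j\<in>J. (cmod (H2_inner y (x j)))\<^sup>2) \<le> B * (H2_norm y)\<^sup>2)"

definition is_frame :: "'j set \<Rightarrow> ('j \<Rightarrow> dirichlet_series) \<Rightarrow> bool" where
  "is_frame J x \<longleftrightarrow> (\<exists>A>0. \<exists>B>0. frame_with_bounds A B J x)"

definition is_parseval_frame :: "'j set \<Rightarrow> ('j \<Rightarrow> dirichlet_series) \<Rightarrow> bool" where
  "is_parseval_frame J x \<longleftrightarrow> frame_with_bounds 1 1 J x"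

definition orbit_family ::
    "(dirichlet_series \<Rightarrow> dirichlet_series) \<Rightarrow> ('i \<Rightarrow> dirichlet_series) \<Rightarrow> 'i \<times> nat \<Rightarrow> dirichlet_series" where
  "orbit_family T D = (\<lambda>(i, n). (T ^^ n) (D i))"

definition frame_of_orbits ::
    "(dirichlet_series \<Rightarrow> dirichlet_series) \<Rightarrow> 'i set \<Rightarrow> ('i \<Rightarrow> dirichlet_series) \<Rightarrow> bool" where
  "frame_of_orbits T I D \<longleftrightarrow>
     countable I \<and> (\<forall>i\<in>I. D i \<in> H2) \<and> is_frame (I \<times> UNIV) (orbit_family T D)"

definition parseval_frame_of_orbits ::
    "(dirichlet_series \<Rightarrow> dirichlet_series) \<Rightarrow> 'i set \<Rightarrow> ('i \<Rightarrow> dirichlet_series) \<Rightarrow> bool" where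
  "parseval_frame_of_orbits T I D \<longleftrightarrow>
     countable I \<and> (\<forall>i\<in>I. D i \<in> H2) \<and> is_parseval_frame (I \<times> UNIV) (orbit_family T D)"

text \<open>
  Existence of a countable family is stated over index sets \<open>I \<subseteq> \<nat>\<close>, finite or infinite;
  a family over any other countable index set can be reindexed by such an \<open>I\<close>.
\<close>

definition admits_frame_of_orbits :: "(dirichlet_series \<Rightarrow> dirichlet_series) \<Rightarrow> bool" where
  "admits_frame_of_orbits T \<longleftrightarrow> (\<exists>(I :: nat set) D. frame_of_orbits T I D)"

definition admits_parseval_frame_of_orbits ::
    "(dirichlet_series \<Rightarrow> dirichlet_series) \<Rightarrow> bool" where
  "admits_parseval_frame_of_orbits T \<longleftrightarrow> (\<exists>(I :: nat set) D. parseval_frame_of_orbits T I D)"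

end

theory Submission
  imports Defs "HOL-Real_Asymp.Real_Asymp"
begin

text \<open>
  Write \<open>T\<close> for multiplication by \<open>D0\<close>. In the basis \<open>n\<^sup>-\<^sup>s\<close> the operator is a lower triangular
  matrix with constant diagonal \<open>a\<^sub>1\<close>: its entry at \<open>(n, k)\<close> is the coefficient of \<open>D0\<close> at \<open>n / k\<close> when
  \<open>k\<close> divides \<open>n\<close>, and \<open>0\<close> otherwise. Hence the adjoint \<open>T*\<close> maps sequences supported on \<open>{1..X}\<close> to
  such sequences. All the work is done on these finite-dimensional spaces; a density argument
  passes to the whole Hilbert space.

  Sufficiency. A holomorphic function bounded by \<open>1\<close> on the half-plane is a contractive multiplier.
  To see it without convergence problems near the imaginary axis, damp the coefficients by
  \<open>exp (- (c ln n)\<^sup>2 / 2)\<close>. The damped series converges absolutely, and it is still bounded by \<open>1\<close>,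
  because a Gaussian is a limit of powers of cosines, and multiplying the \<open>n\<close>-th coefficient by
  \<open>cos (h ln n) ^ m\<close> is the same as taking a convex combination of vertical translates of the function.
  For an absolutely convergent series bounded by \<open>1\<close> on the imaginary axis contractivity follows from
  the mean value formula \<open>mean of \<bar>P(it)\<bar>\<^sup>2 = \<Sum> \<bar>c\<^sub>n\<bar>\<^sup>2\<close>. So \<open>I - T T*\<close> is a positive kernel, and
  a Cholesky factorisation gives vectors \<open>D i\<close> with
  \<open>\<Sum>\<^sub>i \<bar>\<langle>y, D i\<rangle>\<bar>\<^sup>2 = \<parallel>y\<parallel>\<^sup>2 - \<parallel>T* y\<parallel>\<^sup>2\<close>. Replacing \<open>y\<close> by \<open>T*\<^sup>n y\<close> and
  summing over \<open>n\<close> telescopes to \<open>\<parallel>y\<parallel>\<^sup>2\<close>, since \<open>T*\<^sup>n y\<close> tends to \<open>0\<close>: on each finite section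
  \<open>T*\<close> is triangular with diagonal entries of modulus less than \<open>1\<close>. The orbits of the \<open>D i\<close> thus form a
  Parseval frame.

  Necessity. For a frame of orbits with bounds \<open>A, B\<close>, the frame coefficients of \<open>T*\<^sup>n y\<close> are a subfamily of
  those of \<open>y\<close>, so \<open>A \<parallel>T*\<^sup>n y\<parallel>\<^sup>2 \<le> B \<parallel>y\<parallel>\<^sup>2\<close>. In particular the coefficients of all powers
  \<open>D0\<^sup>j\<close> are bounded by one constant. Keep only the terms whose index has no prime factor above \<open>N\<close>.
  This operation is multiplicative, and the kept indices have \<open>\<Sum> n\<^sup>-\<^sup>\<sigma> < \<infinity>\<close> for every
  \<open>\<sigma> > 0\<close>, so the \<open>j\<close>-th powers of the restricted function are bounded in \<open>j\<close>, which forces the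
  function to be bounded by \<open>1\<close>. Let \<open>N\<close> grow: by Montel's theorem the bound passes to \<open>D0\<close>. The
  condition on \<open>a\<^sub>1\<close> comes from first coordinates, on which \<open>T\<close> acts as multiplication by \<open>a\<^sub>1\<close>.

  Infinitely many orbits. On the span of the basis vectors indexed by primes, \<open>T* - cnj a\<^sub>1\<close> has
  rank at most \<open>1\<close>. Given finitely many \<open>D i\<close>, there is therefore an eigenvector \<open>y \<noteq> 0\<close> of \<open>T*\<close> that
  is orthogonal to all of them, hence to all their orbits, which contradicts the lower frame bound.
\<close>

section \<open>Multiplication operators as triangular matrices\<close>

text \<open>
  For \<open>k\<close> between \<open>1\<close> and \<open>n\<close> this is the matrix of multiplication by \<open>a\<close>; it turns the
  sum over factorisations of \<open>n\<close> into a sum over an interval that is independent of \<open>n\<close>.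
\<close>

definition dirichlet_matrix :: "dirichlet_series \<Rightarrow> nat \<Rightarrow> nat \<Rightarrow> complex" where
  "dirichlet_matrix a n k = (if k dvd n then a (n div k) else 0)"

lemma dirichlet_prod_eq_matrix:
  assumes "n \<in> {1..X}"
  shows "dirichlet_prod a x n = (\<Sum>k\<in>{1..X}. dirichlet_matrix a n k * x k)"
proof -
  have n: "n > 0" using assms by auto
  have "dirichlet_prod a x n = (\<Sum>(k, m) | k * m = n. a k * x m)"
    using n by (simp add: dirichlet_prod_def)
  also have "\<dots> = (\<Sum>k | k dvd n. a (n div k) * x k)"
    by (rule sum.reindex_bij_witness[of _ "\<lambda>k. (n div k, k)" snd]) (use n in auto)
  also have "\<dots> = (\<Sum>k\<in>{1..X}. dirichlet_matrix a n k * x k)"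
    by (rule sum.mono_neutral_cong_left)
       (use assms n in \<open>auto simp: dirichlet_matrix_def intro!: Suc_leI Nat.gr0I intro: order.trans[OF dvd_imp_le]\<close>)
  finally show ?thesis .
qed

lemma dirichlet_matrix_lower: "n \<in> {1..} \<Longrightarrow> n < k \<Longrightarrow> dirichlet_matrix a n k = 0"
  by (auto simp: dirichlet_matrix_def dest: dvd_imp_le)

lemma dirichlet_matrix_diag: "n \<in> {1..} \<Longrightarrow> dirichlet_matrix a n n = a 1"
  by (auto simp: dirichlet_matrix_def)

lemma dirichlet_prod_0 [simp]: "dirichlet_prod a x 0 = 0"
  by (simp add: dirichlet_prod_def)

section \<open>Gaussian smoothing of bounded Dirichlet series\<close>

text \<open>
  The expectation of \<open>F\<close> at the position of a symmetric random walk with \<open>M\<close> steps of length \<open>h\<close>.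
  It is a convex combination of values of \<open>F\<close>, and its characteristic function \<open>cos (h L) ^ M\<close> serves
  two purposes: for \<open>h\<close> of order \<open>1 / sqrt M\<close> it tends to a Gaussian, and for small fixed \<open>h\<close> and
  \<open>L \<noteq> 0\<close> it tends to \<open>0\<close>.
\<close>

definition binomial_mean :: "nat \<Rightarrow> real \<Rightarrow> (real \<Rightarrow> complex) \<Rightarrow> complex" where
  "binomial_mean M h F = (\<Sum>k\<le>M. of_real (real (M choose k) / 2 ^ M) * F (h * (2 * real k - real M)))"

lemma binomial_weights_sum: "(\<Sum>k\<le>M. real (M choose k) / 2 ^ M) = 1"
  by (simp flip: sum_divide_distrib of_nat_sum add: choose_row_sum)

lemma binomial_mean_exp:
  "binomial_mean M h (\<lambda>t. exp (\<i> * of_real (t * L))) = of_real (cos (h * L) ^ M)"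
proof -
  define z where "z = exp (\<i> * of_real (h * L))"
  define w where "w = exp (- (\<i> * of_real (h * L)))"
  have "binomial_mean M h (\<lambda>t. exp (\<i> * of_real (t * L))) =
        (\<Sum>k\<le>M. of_nat (M choose k) * z ^ k * w ^ (M - k)) / 2 ^ M"
    unfolding binomial_mean_def sum_divide_distrib
  proof (intro sum.cong refl)
    fix k assume k: "k \<in> {..M}"
    have "z ^ k * w ^ (M - k) = exp (of_nat k * (\<i> * of_real (h * L)) + of_nat (M - k) * (- (\<i> * of_real (h * L))))"
      unfolding z_def w_def exp_add by (simp only: exp_of_nat_mult)
    also have "\<dots> = exp (\<i> * of_real (h * (2 * real k - real M) * L))"
      using k by (intro arg_cong[of _ _ exp]) (simp add: of_nat_diff algebra_simps)
    finally show "of_real (real (M choose k) / 2 ^ M) * exp (\<i> * of_real (h * (2 * real k - real M) * L))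
        = of_nat (M choose k) * z ^ k * w ^ (M - k) / 2 ^ M"
      by (simp add: mult.assoc)
  qed
  also have "\<dots> = (z + w) ^ M / 2 ^ M"
    by (simp add: binomial_ring)
  also have "\<dots> = (cos (of_real (h * L))) ^ M"
    by (simp add: cos_exp_eq z_def w_def power_divide)
  finally show ?thesis by (simp flip: cos_of_real)
qed

lemma binomial_mean_norm:
  assumes "\<And>t. cmod (F t) \<le> C"
  shows "cmod (binomial_mean M h F) \<le> C"
proof -
  have "cmod (binomial_mean M h F) \<le> (\<Sum>k\<le>M. real (M choose k) / 2 ^ M * C)"
    unfolding binomial_mean_def
    by (intro order.trans[OF norm_sum] sum_mono) (auto simp: norm_mult norm_divide norm_power intro!: mult_left_mono divide_right_mono assms)
  also have "\<dots> = C"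
    by (simp flip: sum_distrib_right add: binomial_weights_sum del: times_divide_eq_left)
  finally show ?thesis .
qed

lemma binomial_mean_sum:
  "binomial_mean M h (\<lambda>t. \<Sum>i\<in>A. F i t) = (\<Sum>i\<in>A. binomial_mean M h (F i))"
  unfolding binomial_mean_def sum_distrib_left by (rule sum.swap)

lemma binomial_mean_cmult:
  "binomial_mean M h (\<lambda>t. c * F t) = c * binomial_mean M h F"
  unfolding binomial_mean_def sum_distrib_left by (simp add: mult_ac)

lemma binomial_mean_mono_norm:
  assumes "\<And>t. cmod (F t) ^ 2 \<le> C * cmod (G t) ^ 2"
  shows "Re (binomial_mean M h (\<lambda>t. of_real (cmod (F t) ^ 2))) \<le> C * Re (binomial_mean M h (\<lambda>t. of_real (cmod (G t) ^ 2)))"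
  unfolding binomial_mean_def Re_sum sum_distrib_left
  using assms by (intro sum_mono) (simp add: mult.left_commute[of C] mult_left_mono del: times_divide_eq_left)

lemma cos_power_gaussian:
  "(\<lambda>m. cos (c / sqrt (real m) * L) ^ m) \<longlonglongrightarrow> exp (- (c * L)\<^sup>2 / 2)"
  unfolding power2_eq_square by real_asymp

lemma cmod_nat_powr: "cmod (of_nat n powr (- s)) = real n powr (- Re s)"
  using norm_powr_real_powr[of "of_nat n" "-s"] by simp

lemma nat_powr_eq_exp: "n > 0 \<Longrightarrow> (of_nat n :: complex) powr (- s) = exp (- s * of_real (ln (real n)))"
  by (simp add: powr_def flip: Ln_of_nat)

lemma nat_powr_vertical:
  "n > 0 \<Longrightarrow> (of_nat n :: complex) powr (- (s - \<i> * of_real t)) = of_nat n powr (- s) * exp (\<i> * of_real (t * ln (real n)))"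
  unfolding nat_powr_eq_exp exp_add[symmetric] by (rule arg_cong[of _ _ exp]) (simp add: algebra_simps)

lemma cmod_dirichlet_term_le:
  assumes "\<sigma> \<le> Re s"
  shows "cmod (a n * of_nat n powr (- s)) \<le> cmod (a n) * real n powr (- \<sigma>)"
proof (cases "n = 0")
  case False
  then show ?thesis unfolding norm_mult cmod_nat_powr using assms
    by (intro mult_left_mono powr_mono) auto
qed auto

lemma dirichlet_series_abs_summable:
  assumes "summable (\<lambda>n. cmod (a n) * real n powr (- \<sigma>))" "\<sigma> \<le> Re s"
  shows "summable (\<lambda>n. cmod (a n * of_nat n powr (- s)))"
  by (rule summable_comparison_test'[OF assms(1)]) (use cmod_dirichlet_term_le[OF assms(2)] in auto)

lemma dirichlet_sum_holomorphic:
  assumes "summable (\<lambda>n. cmod (a n) * real n powr (- \<sigma>))"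
  shows "dirichlet_sum a holomorphic_on {s. Re s > \<sigma>}"
proof (rule holomorphic_uniform_sequence)
  show op: "open {s. Re s > \<sigma>}" by (rule open_halfspace_Re_gt)
  show "(\<lambda>s. \<Sum>n<N. a n * of_nat n powr (- s)) holomorphic_on {s. Re s > \<sigma>}" for N
  proof (intro holomorphic_on_sum holomorphic_on_mult holomorphic_on_const)
    fix n show "(\<lambda>s. (of_nat n :: complex) powr (- s)) holomorphic_on {s. Re s > \<sigma>}"
      by (cases "n = 0") (auto simp: nat_powr_eq_exp intro!: holomorphic_intros)
  qed
  have U: "uniform_limit {s. Re s > \<sigma>} (\<lambda>N s. \<Sum>n<N. a n * of_nat n powr (- s)) (dirichlet_sum a) sequentially"
    unfolding dirichlet_sum_def
    by (rule Weierstrass_m_test[OF _ assms]) (rule cmod_dirichlet_term_le, simp)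
  fix x assume "x \<in> {s. Re s > \<sigma>}"
  then obtain d where "d > 0" "cball x d \<subseteq> {s. Re s > \<sigma>}"
    using op open_contains_cball by blast
  then show "\<exists>d>0. cball x d \<subseteq> {s. Re s > \<sigma>} \<and>
    uniform_limit (cball x d) (\<lambda>N s. \<Sum>n<N. a n * of_nat n powr (- s)) (dirichlet_sum a) sequentially"
    using uniform_limit_on_subset[OF U] by blast
qed

text \<open>
  Montel's theorem gives a subsequential limit bounded by \<open>C\<close> on the large half-plane. It agrees with
  \<open>G\<close> far to the right, hence everywhere by analytic continuation. This is how bounds that are
  visible only where series converge absolutely are carried to the imaginary axis.
\<close>

lemma bounded_limit_on_half_plane:
  fixes F :: "nat \<Rightarrow> complex \<Rightarrow> complex"
  assumes hol: "\<And>m. F m holomorphic_on {s. Re s > \<sigma>}"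
    and bd: "\<And>m s. Re s > \<sigma> \<Longrightarrow> cmod (F m s) \<le> C"
    and lim: "\<And>s. Re s > \<tau> \<Longrightarrow> (\<lambda>m. F m s) \<longlonglongrightarrow> G s"
    and G: "G holomorphic_on {s. Re s > \<sigma>}"
    and s: "Re s > \<sigma>"
  shows "cmod (G s) \<le> C"
proof -
  let ?S = "{s. Re s > \<sigma>}"
  obtain g r where g: "g holomorphic_on ?S" and r: "strict_mono (r :: nat \<Rightarrow> nat)"
    and conv: "\<And>x. x \<in> ?S \<Longrightarrow> (\<lambda>n. F (r n) x) \<longlonglongrightarrow> g x"
  proof (rule Montel[of ?S "range F" F], goal_cases)
    case 1
    show ?case by (rule open_halfspace_Re_gt)
  next
    case (3 K)
    then show ?case using bd by (intro exI[of _ C]) auto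
  qed (use hol in auto)
  let ?\<mu> = "max \<sigma> \<tau>"
  have eq: "g z = G z" if "Re z > ?\<mu>" for z
  proof (rule LIMSEQ_unique)
    show "(\<lambda>n. F (r n) z) \<longlonglongrightarrow> g z" using that by (intro conv) auto
    show "(\<lambda>n. F (r n) z) \<longlonglongrightarrow> G z"
      using LIMSEQ_subseq_LIMSEQ[OF lim r] that by (auto simp: o_def)
  qed
  have "g s - G s = 0"
  proof (rule analytic_continuation[where f = "\<lambda>z. g z - G z" and w = s and S = ?S and U = "{z. Re z > ?\<mu>}" and \<xi> = "of_real (?\<mu> + 1)"])
    show "(\<lambda>z. g z - G z) holomorphic_on ?S" by (intro holomorphic_intros g G)
    show "open ?S" by (rule open_halfspace_Re_gt)
    show "connected ?S" by (intro convex_connected convex_halfspace_Re_gt)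
    show "{z. Re z > ?\<mu>} \<subseteq> ?S" by auto
    show "of_real (?\<mu> + 1) \<in> ?S" by auto
    show "of_real (?\<mu> + 1) islimpt {z. Re z > ?\<mu>}"
      by (rule interior_limit_point) (subst interior_open, rule open_halfspace_Re_gt, simp add: max_def)
  qed (use eq s in auto)
  moreover have "cmod (g s) \<le> C"
    by (rule LIMSEQ_le_const2[OF tendsto_norm[OF conv]]) (use s bd in auto)
  ultimately show ?thesis by simp
qed

text \<open>
  The terms of the series tend to zero at the point \<open>s = 1\<close>.
\<close>

lemma Hinf_coeff_growth:
  assumes "a \<in> Hinf"
  obtains C where "C > 0" "\<And>n. cmod (a n) \<le> C * real n"
proof -
  have a0: "a 0 = 0" and "summable (\<lambda>n. a n * of_nat n powr (- 1))"
    using assms by (auto simp: Hinf_def right_half_plane_def)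
  then have "Bseq (\<lambda>n. a n * of_nat n powr (- 1))"
    by (intro convergent_imp_Bseq convergentI[OF summable_LIMSEQ_zero])
  then obtain C where C: "C > 0" "\<And>n. cmod (a n * of_nat n powr (- 1)) \<le> C"
    by (auto simp: Bseq_def)
  show thesis
  proof
    fix n show "cmod (a n) \<le> C * real n"
      using C(2)[of n] a0
      by (cases "n = 0") (auto simp: norm_mult norm_divide cmod_nat_powr powr_minus_divide divide_simps)
  qed (use C in auto)
qed

lemma Hinf_abs_summable:
  assumes "a \<in> Hinf"
  shows "summable (\<lambda>n. cmod (a n) * real n powr (- 3))"
proof -
  obtain C where C: "\<And>n. cmod (a n) \<le> C * real n" using Hinf_coeff_growth[OF assms] by blast
  have "summable (\<lambda>n. C * real n powr (- 2))"
    by (intro summable_mult) (simp add: summable_real_powr_iff)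
  then show ?thesis
  proof (rule summable_comparison_test')
    fix n :: nat assume "n \<ge> 1"
    then have "cmod (a n) * real n powr (- 3) \<le> C * real n * real n powr (- 3)"
      by (intro mult_right_mono C) auto
    also have "\<dots> = C * real n powr (- 2)"
      using powr_add[of "real n" 1 "- 3"] \<open>n \<ge> 1\<close> by simp
    finally show "norm (cmod (a n) * real n powr - 3) \<le> C * real n powr - 2" by simp
  qed
qed

lemma gaussian_smoothing_summable:
  assumes "a \<in> Hinf" "c > 0"
  shows "summable (\<lambda>n. cmod (a n * of_real (exp (- (c * ln (real n))\<^sup>2 / 2))) * real n powr (- 0))"
proof -
  obtain C where C: "C > 0" "\<And>n. cmod (a n) \<le> C * real n" using Hinf_coeff_growth[OF assms(1)] by blast
  have "(\<lambda>n. C * real n * exp (- (c * ln (real n))\<^sup>2 / 2)) \<in> O(\<lambda>n. real n powr (- 2))"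
    using assms(2) C(1) unfolding power2_eq_square by real_asymp
  then have "summable (\<lambda>n. C * real n * exp (- (c * ln (real n))\<^sup>2 / 2))"
    by (rule summable_comparison_test_bigo[rotated]) (simp add: summable_real_powr_iff)
  then show ?thesis
    by (rule summable_comparison_test') (auto simp: norm_mult C intro!: mult_right_mono)
qed

text \<open>
  Binomial means of vertical translates of \<open>dirichlet_sum a\<close> are bounded by \<open>C\<close>. Far to the right,
  where the series converges absolutely, such a mean multiplies the coefficients by
  \<open>cos (c ln n / sqrt m) ^ m\<close>, so these means converge to the series with Gaussian damping.
\<close>

lemma gaussian_smoothing_bounded:
  assumes a: "a \<in> Hinf" and c: "c > 0"
    and bd: "\<And>s. Re s > 0 \<Longrightarrow> cmod (dirichlet_sum a s) \<le> C"
    and s: "Re s > 0"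
  shows "cmod (dirichlet_sum (\<lambda>n. a n * of_real (exp (- (c * ln (real n))\<^sup>2 / 2))) s) \<le> C"
proof -
  define F where "F m s = binomial_mean m (c / sqrt (real m)) (\<lambda>t. dirichlet_sum a (s - \<i> * of_real t))" for m s
  show ?thesis
  proof (rule bounded_limit_on_half_plane[where F = F and \<sigma> = 0 and \<tau> = 3
        and G = "dirichlet_sum (\<lambda>n. a n * of_real (exp (- (c * ln (real n))\<^sup>2 / 2)))"])
    have hol: "dirichlet_sum a holomorphic_on {s. Re s > 0}"
      using a by (simp add: Hinf_def right_half_plane_def)
    show "F m holomorphic_on {s. Re s > 0}" for m
      unfolding F_def binomial_mean_def
      by (intro holomorphic_intros holomorphic_on_compose_gen[OF _ hol, unfolded o_def]) auto
    show "cmod (F m s) \<le> C" if "Re s > 0" for m s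
      unfolding F_def by (intro binomial_mean_norm bd) (use that in auto)
    show "dirichlet_sum (\<lambda>n. a n * of_real (exp (- (c * ln (real n))\<^sup>2 / 2))) holomorphic_on {s. Re s > 0}"
      by (rule dirichlet_sum_holomorphic[OF gaussian_smoothing_summable[OF a c]])
    fix s :: complex assume s: "Re s > 3"
    define u where "u n m = a n * of_nat n powr (- s) * of_real (cos (c / sqrt (real m) * ln (real n)) ^ m)" for n m
    have u: "u n m = binomial_mean m (c / sqrt (real m)) (\<lambda>t. a n * of_nat n powr (- (s - \<i> * of_real t)))" for n m
    proof (cases "n = 0")
      case False
      then have "n > 0" by simp
      show ?thesis
        unfolding u_def nat_powr_vertical[OF \<open>n > 0\<close>] mult.assoc[symmetric] binomial_mean_cmult
          binomial_mean_exp by (rule refl)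
    qed (simp add: u_def binomial_mean_def)
    have abs: "summable (\<lambda>n. a n * of_nat n powr (- (s - \<i> * of_real t)))" for t
      by (rule summable_norm_cancel, rule dirichlet_series_abs_summable[OF Hinf_abs_summable[OF a]])
         (use s in simp)
    have "F m s = (\<Sum>n. u n m)" for m
    proof -
      have "F m s = (\<Sum>k\<le>m. \<Sum>n. of_real (real (m choose k) / 2 ^ m) *
          (a n * of_nat n powr (- (s - \<i> * of_real (c / sqrt (real m) * (2 * real k - real m))))))"
        unfolding F_def binomial_mean_def dirichlet_sum_def by (intro sum.cong refl suminf_mult[symmetric] abs)
      also have "\<dots> = (\<Sum>n. u n m)"
        unfolding u binomial_mean_def by (rule suminf_sum[symmetric]) (intro summable_mult abs)
      finally show ?thesis .
    qed
    moreover have "(\<lambda>m. \<Sum>n. u n m) \<longlonglongrightarrow>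
       (\<Sum>n. a n * of_nat n powr (- s) * of_real (exp (- (c * ln (real n))\<^sup>2 / 2)))"
    proof (rule tannerys_theorem[THEN conjunct2, THEN conjunct2])
      show "u n \<longlonglongrightarrow> a n * of_nat n powr (- s) * of_real (exp (- (c * ln (real n))\<^sup>2 / 2))" for n
        unfolding u_def by (intro tendsto_intros cos_power_gaussian)
      show "summable (\<lambda>n. cmod (a n) * real n powr (- 3))" by (rule Hinf_abs_summable[OF a])
      have "cmod (u n m) \<le> cmod (a n) * real n powr (- 3)" for n m
      proof -
        have "cmod (u n m) \<le> cmod (a n * of_nat n powr (- s)) * 1"
          unfolding u_def norm_mult[of "_ * _"]
          by (intro mult_left_mono) (auto simp: norm_power power_le_one)
        also have "\<dots> \<le> cmod (a n) * real n powr (- 3)"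
          using cmod_dirichlet_term_le[of 3 s a n] s by simp
        finally show ?thesis .
      qed
      then show "\<forall>\<^sub>F (n, m) in at_top \<times>\<^sub>F sequentially. cmod (u n m) \<le> cmod (a n) * real n powr - 3"
        by (intro always_eventually) auto
    qed auto
    ultimately show "(\<lambda>m. F m s) \<longlonglongrightarrow> dirichlet_sum (\<lambda>n. a n * of_real (exp (- (c * ln (real n))\<^sup>2 / 2))) s"
      unfolding dirichlet_sum_def by (simp add: mult_ac)
  qed (use s in auto)
qed

section \<open>Bounded functions are bounded multipliers\<close>

lemma has_sum_times:
  fixes \<alpha> :: "'a \<Rightarrow> complex" and \<beta> :: "'b \<Rightarrow> complex"
  assumes "(\<lambda>k. norm (\<alpha> k)) summable_on A" "(\<lambda>m. norm (\<beta> m)) summable_on B"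
  shows "((\<lambda>(k, m). \<alpha> k * \<beta> m) has_sum infsum \<alpha> A * infsum \<beta> B) (A \<times> B)"
proof (rule has_sum_SigmaI)
  show "((\<lambda>m. case (k, m) of (k, m) \<Rightarrow> \<alpha> k * \<beta> m) has_sum \<alpha> k * infsum \<beta> B) B" for k
    using has_sum_cmult_right[OF has_sum_infsum[OF Infinite_Sum.abs_summable_summable[OF assms(2)]]] by simp
  show "((\<lambda>k. \<alpha> k * infsum \<beta> B) has_sum infsum \<alpha> A * infsum \<beta> B) A"
    using has_sum_cmult_left[OF has_sum_infsum[OF Infinite_Sum.abs_summable_summable[OF assms(1)]]] by simp
  have "(\<lambda>z. norm (case z of (k, m) \<Rightarrow> \<alpha> k * \<beta> m)) summable_on A \<times> B"
    unfolding Infinite_Sum.abs_summable_on_Sigma_iff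
    using assms by (auto simp: norm_mult infsum_cmult_right abs_mult infsum_nonneg
        intro!: summable_on_cmult_right summable_on_cmult_left)
  then show "(\<lambda>(k, m). \<alpha> k * \<beta> m) summable_on A \<times> B"
    by (rule Infinite_Sum.abs_summable_summable)
qed

lemma dirichlet_sum_prod:
  assumes a: "summable (\<lambda>n. cmod (a n * of_nat n powr (- s)))"
    and b: "summable (\<lambda>n. cmod (b n * of_nat n powr (- s)))"
  shows "dirichlet_sum (dirichlet_prod a b) s = dirichlet_sum a s * dirichlet_sum b s"
proof -
  define \<alpha> where "\<alpha> = (\<lambda>n. a n * of_nat n powr (- s))"
  define \<beta> where "\<beta> = (\<lambda>n. b n * of_nat n powr (- s))"
  define \<gamma> where "\<gamma> = (\<lambda>n. dirichlet_prod a b n * of_nat n powr (- s))"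
  let ?P = "{1..} :: nat set"
  have pos: "infsum f ?P = suminf f \<and> (\<lambda>n. cmod (f n)) summable_on ?P"
    if f: "summable (\<lambda>n. cmod (f n))" "f 0 = 0" for f :: "nat \<Rightarrow> complex"
  proof
    have "(f has_sum suminf f) UNIV"
      by (rule norm_summable_imp_has_sum[OF f(1)]) (rule summable_sums[OF summable_norm_cancel[OF f(1)]])
    moreover have "(f has_sum suminf f) UNIV \<longleftrightarrow> (f has_sum suminf f) ?P"
      by (rule has_sum_cong_neutral) (use f(2) in \<open>auto simp: not_le\<close>)
    ultimately show "infsum f ?P = suminf f" by (auto intro: infsumI)
    have "(\<lambda>n. cmod (f n)) summable_on UNIV"
      using f(1) by (intro summable_nonneg_imp_summable_on) auto
    then show "(\<lambda>n. cmod (f n)) summable_on ?P" by (rule summable_on_subset_banach) simp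
  qed
  have \<alpha>: "infsum \<alpha> ?P = suminf \<alpha>" "(\<lambda>n. cmod (\<alpha> n)) summable_on ?P"
    and \<beta>: "infsum \<beta> ?P = suminf \<beta>" "(\<lambda>n. cmod (\<beta> n)) summable_on ?P"
    using pos[of \<alpha>] pos[of \<beta>] a b by (auto simp: \<alpha>_def \<beta>_def)
  have "((\<lambda>(k, m). \<alpha> k * \<beta> m) has_sum suminf \<alpha> * suminf \<beta>) (?P \<times> ?P)"
    using has_sum_times[OF \<alpha>(2) \<beta>(2)] by (simp only: \<alpha>(1) \<beta>(1))
  also have "?this \<longleftrightarrow> ((\<lambda>(n, k, m). \<alpha> k * \<beta> m) has_sum suminf \<alpha> * suminf \<beta>)
      (Sigma ?P (\<lambda>n. {(k, m). k * m = n}))"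
    by (rule has_sum_reindex_bij_witness[of _ snd "\<lambda>(k, m). (k * m, k, m)"])
       (auto simp: Suc_le_eq)
  finally have "(\<gamma> has_sum suminf \<alpha> * suminf \<beta>) ?P"
  proof (rule has_sum_SigmaD)
    fix n :: nat assume "n \<in> ?P"
    then have n: "n > 0" by auto
    have fin: "finite {(k, m). k * m = n}"
      by (rule finite_subset[of _ "{..n} \<times> {..n}"]) (use n in auto)
    have "\<gamma> n = (\<Sum>(k, m) | k * m = n. \<alpha> k * \<beta> m)"
    proof -
      have "a k * b m * of_nat n powr (- s) = \<alpha> k * \<beta> m" if "k * m = n" for k m
      proof -
        have km: "k > 0" "m > 0" using that n by auto
        have "(of_nat n :: complex) powr (- s) = of_nat k powr (- s) * of_nat m powr (- s)"
          unfolding that[symmetric] using km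
          by (simp add: nat_powr_eq_exp ln_mult ring_distribs flip: exp_add del: of_nat_mult) (simp add: ln_mult algebra_simps)
        then show ?thesis by (simp add: \<alpha>_def \<beta>_def)
      qed
      then show ?thesis
        unfolding \<gamma>_def dirichlet_prod_def using n
        by (auto simp: sum_distrib_right intro!: sum.cong)
    qed
    then show "((\<lambda>y. case (n, y) of (n, k, m) \<Rightarrow> \<alpha> k * \<beta> m) has_sum \<gamma> n) {(k, m). k * m = n}"
      using has_sum_finite[OF fin] by simp
  qed
  also have "?this \<longleftrightarrow> (\<gamma> has_sum suminf \<alpha> * suminf \<beta>) UNIV"
    by (rule has_sum_cong_neutral) (auto simp: \<gamma>_def not_le)
  finally show ?thesis
    unfolding dirichlet_sum_def \<alpha>_def \<beta>_def \<gamma>_def by (rule sums_unique[OF has_sum_imp_sums, symmetric])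
qed

lemma dirichlet_sum_finite:
  assumes "\<And>n. n \<notin> {1..X} \<Longrightarrow> c n = 0"
  shows "dirichlet_sum c (- (\<i> * of_real t)) = (\<Sum>n\<in>{1..X}. c n * exp (\<i> * of_real (t * ln (real n))))"
proof -
  have "dirichlet_sum c (- (\<i> * of_real t)) = (\<Sum>n\<in>{1..X}. c n * of_nat n powr (- (- (\<i> * of_real t))))"
    unfolding dirichlet_sum_def by (rule suminf_finite) (use assms in auto)
  also have "\<dots> = (\<Sum>n\<in>{1..X}. c n * exp (\<i> * of_real (t * ln (real n))))"
    by (intro sum.cong refl arg_cong2[of _ _ _ _ "(*)"])
       (use nat_powr_vertical[where s = 0] in auto)
  finally show ?thesis .
qed

text \<open>
  Expanding the square, the mean of the term with indices \<open>n, m\<close> carries the factor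
  \<open>cos (h (ln n - ln m)) ^ M\<close>, so only the diagonal survives in the limit. The step \<open>h = 1 / X\<close> is small
  enough to keep all the arguments of the cosine strictly between \<open>-1\<close> and \<open>1\<close>.
\<close>

lemma dirichlet_polynomial_mean_square:
  assumes c: "\<And>n. n \<notin> {1..X} \<Longrightarrow> c n = 0" and X: "X > 0"
  shows "(\<lambda>M. Re (binomial_mean M (1 / real X) (\<lambda>t. of_real (cmod (dirichlet_sum c (- (\<i> * of_real t))) ^ 2))))
           \<longlonglongrightarrow> (\<Sum>n\<in>{1..X}. (cmod (c n))\<^sup>2)"
proof -
  have 1: "of_real (cmod (dirichlet_sum c (- (\<i> * of_real t))) ^ 2) =
      (\<Sum>n\<in>{1..X}. \<Sum>m\<in>{1..X}. c n * cnj (c m) * exp (\<i> * of_real (t * (ln (real n) - ln (real m)))))" for t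
  proof -
    have P: "dirichlet_sum c (- (\<i> * of_real t)) = (\<Sum>n\<in>{1..X}. c n * exp (\<i> * of_real (t * ln (real n))))"
      by (rule dirichlet_sum_finite) (use c in auto)
    show ?thesis
      unfolding complex_norm_square P cnj_sum sum_product
      by (intro sum.cong refl) (simp add: exp_cnj exp_diff algebra_simps exp_minus divide_simps)
  qed
  have 2: "(\<lambda>M. Re (c n * cnj (c m) * of_real (cos (1 / real X * (ln (real n) - ln (real m))) ^ M)))
      \<longlonglongrightarrow> (if m = n then (cmod (c n))\<^sup>2 else 0)" if nm: "n \<in> {1..X}" "m \<in> {1..X}" for n m
  proof (cases "n = m")
    case True
    then show ?thesis by (simp flip: complex_norm_square)
  next
    case False
    let ?x = "1 / real X * (ln (real n) - ln (real m))"
    have "?x \<noteq> 0" using False X nm by auto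
    moreover have "\<bar>?x\<bar> < 1"
    proof -
      have ln: "0 \<le> ln (real k) \<and> ln (real k) < X" if "k \<in> {1..X}" for k
      proof -
        have "ln (real k) < real k" using that by (intro ln_less_self) auto
        also have "\<dots> \<le> X" using that by auto
        finally show ?thesis using that by auto
      qed
      have "\<bar>ln (real n) - ln (real m)\<bar> < X" using ln[OF nm(1)] ln[OF nm(2)] by linarith
      then show ?thesis using X by (simp add: abs_mult field_simps)
    qed
    ultimately have "norm (cos ?x) < 1"
    proof -
      have "cos \<bar>?x\<bar> < cos 0"
        by (rule cos_monotone_0_pi) (use \<open>?x \<noteq> 0\<close> \<open>\<bar>?x\<bar> < 1\<close> pi_gt3 in \<open>auto simp del: abs_divide abs_mult\<close>)
      moreover have "cos \<bar>?x\<bar> > 0"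
        by (rule cos_gt_zero) (use \<open>?x \<noteq> 0\<close> \<open>\<bar>?x\<bar> < 1\<close> pi_gt3 in linarith)+
      ultimately show ?thesis by (simp only: cos_abs_real cos_zero abs_of_pos real_norm_def)
    qed
    then have lim: "(\<lambda>M. cos ?x ^ M) \<longlonglongrightarrow> 0" by (rule LIMSEQ_power_zero)
    have "(\<lambda>M. Re (c n * cnj (c m) * of_real (cos ?x ^ M))) \<longlonglongrightarrow> Re (c n * cnj (c m) * of_real 0)"
      by (intro tendsto_Re tendsto_mult tendsto_const tendsto_of_real lim)
    then show ?thesis using False by simp
  qed
  have "(\<lambda>M. \<Sum>n\<in>{1..X}. \<Sum>m\<in>{1..X}. Re (c n * cnj (c m) * of_real (cos (1 / real X * (ln (real n) - ln (real m))) ^ M)))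
    \<longlonglongrightarrow> (\<Sum>n\<in>{1..X}. \<Sum>m\<in>{1..X}. (if m = n then (cmod (c n))\<^sup>2 else 0))"
    by (intro tendsto_sum 2)
  then show ?thesis
    unfolding 1 binomial_mean_sum binomial_mean_cmult binomial_mean_exp Re_sum
    by (simp add: sum.delta)
qed

lemma dirichlet_prod_cong:
  assumes "n \<in> {1..X}" "\<And>k. k \<in> {1..X} \<Longrightarrow> x k = y k"
  shows "dirichlet_prod a x n = dirichlet_prod a y n"
  unfolding dirichlet_prod_eq_matrix[OF assms(1)] using assms(2) by simp

lemma dirichlet_prod_cong_left:
  assumes "n \<in> {1..X}" "\<And>k. k \<in> {1..X} \<Longrightarrow> a k = b k"
  shows "dirichlet_prod a x n = dirichlet_prod b x n"
proof -
  have "dirichlet_matrix a n k = dirichlet_matrix b n k" if "k \<in> {1..X}" for k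
    using assms that unfolding dirichlet_matrix_def
    by (auto intro!: assms(2) intro: order.trans[OF div_le_dividend] simp: Suc_le_eq div_greater_zero_iff dvd_imp_le)
  then show ?thesis unfolding dirichlet_prod_eq_matrix[OF assms(1)] by simp
qed

lemma dirichlet_prod_support:
  assumes a: "\<And>n. n \<notin> {1..N} \<Longrightarrow> a n = 0" and x: "\<And>n. n \<notin> {1..X} \<Longrightarrow> x n = 0"
    and n: "n \<notin> {1..N * X}"
  shows "dirichlet_prod a x n = 0"
proof (cases "n = 0")
  case False
  have "a k * x m = 0" if "k * m = n" for k m
  proof (rule ccontr)
    assume "a k * x m \<noteq> 0"
    then have "k \<in> {1..N}" "m \<in> {1..X}" using a x by auto
    then have "n \<le> N * X" using that by (auto intro!: mult_le_mono)
    then show False using n False by auto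
  qed
  then show ?thesis by (auto simp: dirichlet_prod_def intro!: sum.neutral)
qed auto

text \<open>
  The pointwise inequality between the moduli of \<open>p x\<close> and \<open>C x\<close> on the imaginary axis is averaged;
  mean squares are sums of squares of coefficients.
\<close>

lemma dirichlet_polynomial_multiplier_bound:
  assumes p: "\<And>n. n \<notin> {1..N} \<Longrightarrow> p n = 0"
    and bd: "\<And>t. cmod (dirichlet_sum p (- (\<i> * of_real t))) \<le> C"
  shows "(\<Sum>n\<in>{1..X}. (cmod (dirichlet_prod p x n))\<^sup>2) \<le> C\<^sup>2 * (\<Sum>n\<in>{1..X}. (cmod (x n))\<^sup>2)"
proof (cases "X = 0")
  case False
  define z where "z = (\<lambda>n. if n \<in> {1..X} then x n else 0)"
  define q where "q = dirichlet_prod p z"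
  define Y where "Y = N * X + X"
  have z: "z n = 0" if "n \<notin> {1..X}" for n using that by (auto simp: z_def)
  have zY: "z n = 0" if "n \<notin> {1..Y}" for n using that by (auto simp: z_def Y_def)
  have qY: "q n = 0" if "n \<notin> {1..Y}" for n
    unfolding q_def by (rule dirichlet_prod_support[OF p z]) (use that in \<open>auto simp: Y_def\<close>)
  have fin: "summable (\<lambda>n. cmod (c n * w n))" if "\<And>n. n \<notin> {1..K} \<Longrightarrow> c n = 0" for K :: nat and c w :: "nat \<Rightarrow> complex"
    by (rule summable_finite[of "{1..K}"]) (use that in auto)
  have "dirichlet_sum q s = dirichlet_sum p s * dirichlet_sum z s" for s
    unfolding q_def by (intro dirichlet_sum_prod fin[OF p] fin[OF z])
  then have "cmod (dirichlet_sum q (- (\<i> * of_real t))) ^ 2 \<le> C\<^sup>2 * cmod (dirichlet_sum z (- (\<i> * of_real t))) ^ 2" for t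
    using bd[of t] by (simp add: norm_mult power_mult_distrib mult_right_mono power_mono)
  note mono = binomial_mean_mono_norm[OF this]
  have Y: "Y > 0" using False by (simp add: Y_def)
  have "(\<Sum>n\<in>{1..Y}. (cmod (q n))\<^sup>2) \<le> C\<^sup>2 * (\<Sum>n\<in>{1..Y}. (cmod (z n))\<^sup>2)"
    by (rule LIMSEQ_le[OF dirichlet_polynomial_mean_square[OF qY Y]
           tendsto_mult_left[OF dirichlet_polynomial_mean_square[OF zY Y]]])
       (use mono in auto)
  also have "(\<Sum>n\<in>{1..Y}. (cmod (z n))\<^sup>2) = (\<Sum>n\<in>{1..X}. (cmod (x n))\<^sup>2)"
    by (rule sum.mono_neutral_cong_right) (auto simp: z_def Y_def)
  finally have "(\<Sum>n\<in>{1..Y}. (cmod (q n))\<^sup>2) \<le> C\<^sup>2 * (\<Sum>n\<in>{1..X}. (cmod (x n))\<^sup>2)" .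
  moreover have "(\<Sum>n\<in>{1..X}. (cmod (q n))\<^sup>2) \<le> (\<Sum>n\<in>{1..Y}. (cmod (q n))\<^sup>2)"
    by (rule sum_mono2) (auto simp: Y_def)
  moreover have "dirichlet_prod p x n = q n" if "n \<in> {1..X}" for n
    unfolding q_def by (rule dirichlet_prod_cong[OF that]) (auto simp: z_def)
  ultimately show ?thesis by simp
qed simp

text \<open>
  Partial sums exceed \<open>C\<close> on the imaginary axis by at most the tail \<open>\<rho> N\<close>, and the first \<open>X\<close>
  coefficients of a product depend only on the first \<open>X\<close> coefficients of its factors.
\<close>

lemma abs_summable_multiplier_bound:
  assumes sm: "summable (\<lambda>n. cmod (b n))"
    and bd: "\<And>t. cmod (dirichlet_sum b (- (\<i> * of_real t))) \<le> C"
  shows "(\<Sum>n\<in>{1..X}. (cmod (dirichlet_prod b x n))\<^sup>2) \<le> C\<^sup>2 * (\<Sum>n\<in>{1..X}. (cmod (x n))\<^sup>2)"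
proof -
  define p where "p = (\<lambda>N n. if n \<in> {1..N} then b n else 0)"
  define \<rho> where "\<rho> = (\<lambda>N. \<Sum>n. cmod (b (n + Suc N)))"
  have "\<rho> \<longlonglongrightarrow> 0"
  proof -
    have \<rho>: "\<rho> = (\<lambda>N. suminf (\<lambda>n. cmod (b n)) - (\<Sum>n<Suc N. cmod (b n)))"
      unfolding \<rho>_def by (rule ext, rule suminf_minus_initial_segment[OF sm])
    have "(\<lambda>N. suminf (\<lambda>n. cmod (b n)) - (\<Sum>n<Suc N. cmod (b n))) \<longlonglongrightarrow>
        suminf (\<lambda>n. cmod (b n)) - suminf (\<lambda>n. cmod (b n))"
      by (intro tendsto_diff tendsto_const LIMSEQ_Suc[OF summable_LIMSEQ[OF sm]])
    then show ?thesis unfolding \<rho> by (simp only: diff_self)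
  qed
  have bound: "cmod (dirichlet_sum (p N) (- (\<i> * of_real t))) \<le> C + \<rho> N" for N t
  proof -
    define u where "u = (\<lambda>n. b n * of_nat n powr (- (- (\<i> * of_real t))))"
    have le: "cmod (u n) \<le> cmod (b n)" for n
      unfolding u_def using cmod_dirichlet_term_le[of 0 "- (\<i> * of_real t)" b n] by (cases "n = 0") auto
    have su: "summable (\<lambda>n. cmod (u n))"
      by (rule summable_comparison_test'[OF sm]) (use le in auto)
    have "dirichlet_sum (p N) (- (\<i> * of_real t)) = (\<Sum>n<Suc N. u n)"
      unfolding dirichlet_sum_def
      by (subst suminf_finite[of "{..<Suc N}"]) (auto simp: p_def u_def Suc_le_eq intro!: sum.cong)
    also have "\<dots> = suminf u - (\<Sum>n. u (n + Suc N))"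
      using suminf_minus_initial_segment[OF summable_norm_cancel[OF su], of "Suc N"] by simp
    finally have "cmod (dirichlet_sum (p N) (- (\<i> * of_real t))) \<le> cmod (suminf u) + cmod (\<Sum>n. u (n + Suc N))"
      by (metis norm_triangle_ineq4)
    moreover have "cmod (suminf u) \<le> C" using bd[of t] by (simp add: u_def dirichlet_sum_def)
    moreover have "cmod (\<Sum>n. u (n + Suc N)) \<le> \<rho> N"
    proof -
      have "cmod (\<Sum>n. u (n + Suc N)) \<le> (\<Sum>n. cmod (u (n + Suc N)))"
        by (rule summable_norm) (rule summable_ignore_initial_segment[OF su])
      also have "\<dots> \<le> \<rho> N"
        unfolding \<rho>_def by (intro suminf_le le summable_ignore_initial_segment[OF su] summable_ignore_initial_segment[OF sm])
      finally show ?thesis .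
    qed
    ultimately show ?thesis by linarith
  qed
  show ?thesis
  proof (rule LIMSEQ_le)
    show "(\<lambda>N. \<Sum>n\<in>{1..X}. (cmod (dirichlet_prod (p N) x n))\<^sup>2) \<longlonglongrightarrow> (\<Sum>n\<in>{1..X}. (cmod (dirichlet_prod b x n))\<^sup>2)"
    proof (rule tendsto_eventually, rule eventually_sequentiallyI[of X])
      fix N assume "X \<le> N"
      then have "dirichlet_prod (p N) x n = dirichlet_prod b x n" if "n \<in> {1..X}" for n
        by (intro dirichlet_prod_cong_left[OF that]) (auto simp: p_def)
      then show "(\<Sum>n\<in>{1..X}. (cmod (dirichlet_prod (p N) x n))\<^sup>2) = (\<Sum>n\<in>{1..X}. (cmod (dirichlet_prod b x n))\<^sup>2)"
        by simp
    qed
    show "(\<lambda>N. (C + \<rho> N)\<^sup>2 * (\<Sum>n\<in>{1..X}. (cmod (x n))\<^sup>2)) \<longlonglongrightarrow> C\<^sup>2 * (\<Sum>n\<in>{1..X}. (cmod (x n))\<^sup>2)"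
      using \<open>\<rho> \<longlonglongrightarrow> 0\<close> by (auto intro!: tendsto_eq_intros)
    show "\<exists>K. \<forall>N\<ge>K. (\<Sum>n\<in>{1..X}. (cmod (dirichlet_prod (p N) x n))\<^sup>2) \<le> (C + \<rho> N)\<^sup>2 * (\<Sum>n\<in>{1..X}. (cmod (x n))\<^sup>2)"
      by (intro exI allI impI dirichlet_polynomial_multiplier_bound[OF _ bound]) (auto simp: p_def)
  qed
qed

text \<open>
  The half of the multiplier theorem for \<open>H2\<close> that says that a bounded function is a bounded
  multiplier, stated for the finite sections of the matrix. The Gaussian damping makes the series
  absolutely convergent, and a translation by \<open>\<delta> k\<close> moves the imaginary axis into the open half-plane;
  both are removed in the limit.
\<close>

lemma Hinf_multiplier_bound:
  assumes a: "a \<in> Hinf" and bd: "\<And>s. Re s > 0 \<Longrightarrow> cmod (dirichlet_sum a s) \<le> C"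
  shows "(\<Sum>n\<in>{1..X}. (cmod (dirichlet_prod a x n))\<^sup>2) \<le> C\<^sup>2 * (\<Sum>n\<in>{1..X}. (cmod (x n))\<^sup>2)"
proof -
  define \<delta> where "\<delta> = (\<lambda>k. 1 / real (Suc k))"
  define g where "g = (\<lambda>k n. a n * of_real (exp (- (\<delta> k * ln (real n))\<^sup>2 / 2)))"
  define b where "b = (\<lambda>k n. g k n * of_nat n powr (- of_real (\<delta> k)))"
  have \<delta>: "\<delta> k > 0" for k by (simp add: \<delta>_def)
  have \<delta>0: "\<delta> \<longlonglongrightarrow> 0" unfolding \<delta>_def by (rule LIMSEQ_Suc[OF lim_const_over_n])
  have le: "(\<Sum>n\<in>{1..X}. (cmod (dirichlet_prod (b k) x n))\<^sup>2) \<le> C\<^sup>2 * (\<Sum>n\<in>{1..X}. (cmod (x n))\<^sup>2)" for k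
  proof (rule abs_summable_multiplier_bound)
    have "summable (\<lambda>n. cmod (g k n) * real n powr (- 0))"
      unfolding g_def by (rule gaussian_smoothing_summable[OF a \<delta>])
    then show "summable (\<lambda>n. cmod (b k n))"
      unfolding b_def by (rule dirichlet_series_abs_summable)
         (use \<delta>[of k] in simp)
    fix t
    have "dirichlet_sum (b k) (- (\<i> * of_real t)) = dirichlet_sum (g k) (of_real (\<delta> k) - \<i> * of_real t)"
      unfolding dirichlet_sum_def b_def mult.assoc
    proof (intro suminf_cong arg_cong2[of _ _ _ _ "(*)"] refl)
      fix n show "(of_nat n :: complex) powr (- of_real (\<delta> k)) * of_nat n powr (- (- (\<i> * of_real t))) =
          of_nat n powr (- (of_real (\<delta> k) - \<i> * of_real t))"
        by (cases "n = 0") (auto simp flip: powr_add)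
    qed
    moreover have "cmod (dirichlet_sum (g k) (of_real (\<delta> k) - \<i> * of_real t)) \<le> C"
      unfolding g_def by (rule gaussian_smoothing_bounded[OF a \<delta> bd]) (use \<delta>[of k] in auto)
    ultimately show "cmod (dirichlet_sum (b k) (- (\<i> * of_real t))) \<le> C" by simp
  qed
  have b: "(\<lambda>k. b k n) \<longlonglongrightarrow> a n" if "n > 0" for n
  proof -
    have "(\<lambda>k. a n * of_real (exp (- (\<delta> k * ln (real n))\<^sup>2 / 2)) * exp (- of_real (\<delta> k) * of_real (ln (real n))))
       \<longlonglongrightarrow> a n * of_real (exp (- (0 * ln (real n))\<^sup>2 / 2)) * exp (- of_real 0 * of_real (ln (real n)))"
      by (intro tendsto_intros \<delta>0) auto
    then show ?thesis using that by (simp add: b_def g_def nat_powr_eq_exp)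
  qed
  show ?thesis
  proof (rule LIMSEQ_le_const2)
    have "(\<lambda>k. dirichlet_prod (b k) x n) \<longlonglongrightarrow> dirichlet_prod a x n" if "n \<in> {1..X}" for n
      unfolding dirichlet_prod_eq_matrix[OF that] using that
      by (intro tendsto_intros) (auto simp: dirichlet_matrix_def div_greater_zero_iff dvd_imp_le intro!: b)
    then show "(\<lambda>k. \<Sum>n\<in>{1..X}. (cmod (dirichlet_prod (b k) x n))\<^sup>2) \<longlonglongrightarrow> (\<Sum>n\<in>{1..X}. (cmod (dirichlet_prod a x n))\<^sup>2)"
      by (intro tendsto_intros) auto
  qed (use le in auto)
qed

section \<open>Cholesky factorisation of positive kernels\<close>

definition kernel_form :: "(nat \<Rightarrow> nat \<Rightarrow> complex) \<Rightarrow> nat \<Rightarrow> (nat \<Rightarrow> complex) \<Rightarrow> complex" where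
  "kernel_form K N c = (\<Sum>n\<le>N. \<Sum>m\<le>N. cnj (c n) * K n m * c m)"

definition positive_kernel :: "(nat \<Rightarrow> nat \<Rightarrow> complex) \<Rightarrow> bool" where
  "positive_kernel K \<longleftrightarrow> (\<forall>n m. K m n = cnj (K n m)) \<and> (\<forall>N c. 0 \<le> Re (kernel_form K N c))"

lemma positive_kernelD:
  assumes "positive_kernel K"
  shows "K m n = cnj (K n m)" "0 \<le> Re (kernel_form K N c)"
  using assms unfolding positive_kernel_def by blast+

lemma kernel_form_perturb:
  assumes herm: "\<And>n m. K m n = cnj (K n m)" and k: "k \<le> N"
  shows "kernel_form K N (\<lambda>n. c n + (if n = k then t else 0)) =
    kernel_form K N c + t * (\<Sum>n\<le>N. cnj (c n) * K n k) + cnj (t * (\<Sum>n\<le>N. cnj (c n) * K n k)) + cnj t * t * K k k"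
proof -
  have "kernel_form K N (\<lambda>n. c n + (if n = k then t else 0)) =
     (\<Sum>n\<le>N. \<Sum>m\<le>N. cnj (c n) * K n m * c m + (if m = k then cnj (c n) * K n k * t else 0)
        + ((if n = k then cnj t * K k m * c m else 0) + (if m = k then if n = k then cnj t * K k k * t else 0 else 0)))"
    unfolding kernel_form_def by (intro sum.cong refl) (auto simp: algebra_simps)
  also have "\<dots> = kernel_form K N c + (\<Sum>n\<le>N. cnj (c n) * K n k * t)
      + ((\<Sum>m\<le>N. \<Sum>n\<le>N. if n = k then cnj t * K k m * c m else 0) + cnj t * K k k * t)"
    unfolding sum.distrib kernel_form_def using k
    by (subst (3) sum.swap) (simp add: sum.delta)
  also have "(\<Sum>m\<le>N. \<Sum>n\<le>N. if n = k then cnj t * K k m * c m else 0) = (\<Sum>m\<le>N. cnj t * cnj (K m k) * c m)"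
    using k by (simp add: sum.delta herm[of k])
  finally show ?thesis
    by (simp add: sum_distrib_left algebra_simps)
qed

lemma kernel_form_extend:
  assumes "N \<le> N'" "\<And>n. n > N \<Longrightarrow> c n = 0"
  shows "kernel_form K N' c = kernel_form K N c"
proof -
  have c: "c n = 0" if "\<not> n \<le> N" for n using assms(2) that by simp
  show ?thesis
    unfolding kernel_form_def
    by (intro sum.mono_neutral_cong_right) (use assms(1) in \<open>auto simp: c intro!: sum.mono_neutral_right\<close>)
qed

lemma positive_kernel_diag:
  assumes "positive_kernel K"
  shows "K k k = of_real (Re (K k k))" "Re (K k k) \<ge> 0"
proof -
  have "K k k = cnj (K k k)" by (rule positive_kernelD[OF assms])
  then show "K k k = of_real (Re (K k k))" by (simp add: complex_eq_iff)
  have "kernel_form K k (\<lambda>n. if n = k then 1 else 0) = K k k"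
    unfolding kernel_form_def by (simp add: if_distrib[of cnj] if_distrib[of "\<lambda>x. x * _"] if_distrib[of "\<lambda>x. _ * x"] sum.delta cong: if_cong)
  then show "Re (K k k) \<ge> 0" using positive_kernelD(2)[OF assms, of k] by metis
qed

lemma positive_kernel_perturb:
  assumes K: "positive_kernel K" and "k \<le> N"
  shows "0 \<le> Re (kernel_form K N c) + 2 * Re (t * (\<Sum>n\<le>N. cnj (c n) * K n k)) + (cmod t)\<^sup>2 * Re (K k k)"
proof -
  have "0 \<le> Re (kernel_form K N (\<lambda>n. c n + (if n = k then t else 0)))"
    by (rule positive_kernelD[OF K])
  also have "\<dots> = Re (kernel_form K N c) + 2 * Re (t * (\<Sum>n\<le>N. cnj (c n) * K n k)) + Re (cnj t * t * K k k)"
  proof -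
    have "Re (A + w + cnj w + B) = Re A + 2 * Re w + Re B" for A w B by simp
    then show ?thesis unfolding kernel_form_perturb[OF positive_kernelD(1)[OF K] \<open>k \<le> N\<close>] .
  qed
  also have "cnj t * t * K k k = of_real ((cmod t)\<^sup>2 * Re (K k k))"
    unfolding of_real_mult complex_norm_square positive_kernel_diag(1)[OF K, of k, symmetric] by simp
  finally show ?thesis by simp
qed

text \<open>
  If \<open>K n k\<close> were nonzero, the form at \<open>e\<^sub>n + t e\<^sub>k\<close> would be a nonconstant affine function
  along a real line of values of \<open>t\<close>, hence negative somewhere.
\<close>

lemma positive_kernel_zero_pivot:
  assumes K: "positive_kernel K" and "K k k = 0"
  shows "K n k = 0"
proof (rule ccontr)
  assume nz: "K n k \<noteq> 0"
  define c where "c = (\<lambda>i. if i = n then 1 else 0 :: complex)"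
  define N where "N = max n k"
  have S: "(\<Sum>i\<le>N. cnj (c i) * K i k) = K n k"
    by (simp add: c_def N_def if_distrib[of cnj] if_distrib[of "\<lambda>x. x * _"] sum.delta cong: if_cong)
  \<comment> \<open>The form at \<open>e\<^sub>n + t e\<^sub>k\<close> equals \<open>-1\<close> for this choice of \<open>t = - r * cnj (K n k)\<close>.\<close>
  define r where "r = (Re (kernel_form K N c) + 1) / (2 * (cmod (K n k))\<^sup>2)"
  have "0 \<le> Re (kernel_form K N c) + 2 * Re (- of_real r * cnj (K n k) * K n k)"
    using positive_kernel_perturb[OF K, of k N c "- of_real r * cnj (K n k)"] unfolding S assms(2)
    by (simp add: N_def)
  also have "- of_real r * cnj (K n k) * K n k = of_real (- r * (cmod (K n k))\<^sup>2)"
    unfolding of_real_mult complex_norm_square by simp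
  finally show False using nz by (simp add: r_def)
qed

definition schur_complement :: "nat \<Rightarrow> (nat \<Rightarrow> nat \<Rightarrow> complex) \<Rightarrow> nat \<Rightarrow> nat \<Rightarrow> complex" where
  "schur_complement k K n m = K n m - K n k * cnj (K m k) / K k k"

text \<open>
  For \<open>K k k > 0\<close> the form of the Schur complement at \<open>c\<close> is the minimum over \<open>t\<close> of the form of
  \<open>K\<close> at \<open>c + t e\<^sub>k\<close>; \<open>t = - cnj S / K k k\<close> attains it. If the pivot vanishes, the subtracted term
  is \<open>0\<close> because division by zero yields zero.
\<close>

lemma positive_kernel_schur:
  assumes K: "positive_kernel K"
  shows "positive_kernel (schur_complement k K)"
  unfolding positive_kernel_def
proof (intro conjI allI)
  have herm: "K m n = cnj (K n m)" for n m by (rule positive_kernelD[OF K])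
  show "schur_complement k K m n = cnj (schur_complement k K n m)" for n m
    by (simp add: schur_complement_def flip: herm)
  fix N :: nat and c :: "nat \<Rightarrow> complex"
  define d where "d = (\<lambda>n. if n \<le> N then c n else 0)"
  define M where "M = max N k"
  define S where "S = (\<Sum>n\<le>M. cnj (d n) * K n k)"
  have form: "kernel_form (schur_complement k K) M d = kernel_form K M d - S * cnj S / K k k"
    unfolding kernel_form_def S_def cnj_sum sum_product
    by (simp add: schur_complement_def algebra_simps sum_subtractf sum_divide_distrib)
  have "0 \<le> Re (kernel_form (schur_complement k K) M d)"
  proof (cases "K k k = 0")
    case True
    then show ?thesis using positive_kernelD(2)[OF K] unfolding form by simp
  next
    case False
    define \<kappa> where "\<kappa> = Re (K k k)"
    have \<kappa>: "K k k = of_real \<kappa>" "\<kappa> > 0"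
      using positive_kernel_diag[OF K, of k] False by (auto simp: \<kappa>_def less_le)
    have "0 \<le> Re (kernel_form K M d) + 2 * Re (- cnj S / of_real \<kappa> * S) + (cmod (- cnj S / of_real \<kappa>))\<^sup>2 * \<kappa>"
      unfolding S_def \<kappa>_def by (rule positive_kernel_perturb[OF K]) (simp add: M_def)
    also have "- cnj S / of_real \<kappa> * S = of_real (- ((cmod S)\<^sup>2 / \<kappa>))"
      unfolding of_real_minus of_real_divide complex_norm_square by simp
    also have "(cmod (- cnj S / of_real \<kappa>))\<^sup>2 * \<kappa> = (cmod S)\<^sup>2 / \<kappa>"
      using \<kappa>(2) by (simp add: norm_divide power_divide power2_eq_square)
    also have "Re (kernel_form K M d) + 2 * Re (of_real (- ((cmod S)\<^sup>2 / \<kappa>))) + (cmod S)\<^sup>2 / \<kappa> =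
        Re (kernel_form (schur_complement k K) M d)"
      unfolding form \<kappa>(1) complex_norm_square[symmetric] by (simp flip: of_real_divide)
    finally show ?thesis .
  qed
  also have "kernel_form (schur_complement k K) M d = kernel_form (schur_complement k K) N d"
    by (rule kernel_form_extend) (auto simp: M_def d_def)
  also have "\<dots> = kernel_form (schur_complement k K) N c"
    by (simp add: kernel_form_def d_def)
  finally show "0 \<le> Re (kernel_form (schur_complement k K) N c)" .
qed

text \<open>
  Gaussian elimination: the \<open>k\<close>-th Schur complement clears row and column \<open>k\<close>, and the term that it
  subtracts is the rank one kernel of the \<open>k\<close>-th column of the factor.
\<close>

lemma positive_kernel_cholesky:
  assumes "positive_kernel K"
  obtains L :: "nat \<Rightarrow> nat \<Rightarrow> complex"
  where "\<And>k n. n < k \<Longrightarrow> L k n = 0" "\<And>N n m. n \<le> N \<Longrightarrow> K n m = (\<Sum>k\<le>N. L k n * cnj (L k m))"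
proof -
  define R where "R = rec_nat K schur_complement"
  have R0: "R 0 = K" and RS: "R (Suc k) = schur_complement k (R k)" for k
    by (simp_all add: R_def)
  have pos: "positive_kernel (R k)" for k
    by (induction k) (use assms in \<open>auto simp: R0 RS positive_kernel_schur\<close>)
  have herm: "R k m n = cnj (R k n m)" for k n m by (rule positive_kernelD[OF pos])
  have zero: "R k n m = 0" if "n < k" for k n m
    using that
  proof (induction k arbitrary: n m)
    case (Suc k)
    show ?case
    proof (cases "n < k")
      case True
      then show ?thesis by (simp add: RS schur_complement_def Suc.IH)
    next
      case False
      then have n: "n = k" using Suc.prems by simp
      have "R k k m = 0" if "R k k k = 0"
        using positive_kernel_zero_pivot[OF pos that, of m] herm[of k k m] by simp
      then show ?thesis unfolding n using herm[of k k m] by (auto simp: RS schur_complement_def)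
    qed
  qed simp
  define L where "L = (\<lambda>k n. R k n k / of_real (sqrt (Re (R k k k))))"
  have L: "L k n * cnj (L k m) = R k n k * cnj (R k m k) / R k k k" for k n m
  proof -
    have "L k n * cnj (L k m) = R k n k * cnj (R k m k) / of_real (sqrt (Re (R k k k)) * sqrt (Re (R k k k)))"
      unfolding L_def complex_cnj_divide complex_cnj_complex_of_real of_real_mult times_divide_times_eq by (rule refl)
    also have "sqrt (Re (R k k k)) * sqrt (Re (R k k k)) = Re (R k k k)"
      using positive_kernel_diag(2)[OF pos, of k k] by simp
    finally show ?thesis using positive_kernel_diag(1)[OF pos, of k k] by simp
  qed
  have sum: "K n m = (\<Sum>k<N. L k n * cnj (L k m)) + R N n m" for N n m
    by (induction N) (simp_all add: R0 RS schur_complement_def L)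
  show thesis
  proof
    show "L k n = 0" if "n < k" for k n using that by (simp add: L_def zero)
    show "K n m = (\<Sum>k\<le>N. L k n * cnj (L k m))" if "n \<le> N" for N n m
      using sum[of n m "Suc N"] that by (simp add: zero lessThan_Suc_atMost)
  qed
qed

section \<open>Adjoints on finite sections and defect vectors\<close>

text \<open>
  The adjoint of multiplication by \<open>a\<close>, on sequences supported on \<open>{1..X}\<close>. By triangularity the
  adjoint of the operator on \<open>H2\<close> preserves these sequences, so this finite matrix computes it.
\<close>

definition dirichlet_adjoint :: "dirichlet_series \<Rightarrow> nat \<Rightarrow> dirichlet_series \<Rightarrow> dirichlet_series" where
  "dirichlet_adjoint a X y k =
     (if k \<in> {1..X} then \<Sum>n\<in>{1..X}. cnj (dirichlet_matrix a n k) * y n else 0)"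

definition section_inner :: "nat \<Rightarrow> dirichlet_series \<Rightarrow> dirichlet_series \<Rightarrow> complex" where
  "section_inner X y x = (\<Sum>n\<in>{1..X}. y n * cnj (x n))"

definition section_norm2 :: "nat \<Rightarrow> dirichlet_series \<Rightarrow> real" where
  "section_norm2 X y = (\<Sum>n\<in>{1..X}. (cmod (y n))\<^sup>2)"

lemma section_inner_self: "section_inner X y y = of_real (section_norm2 X y)"
  unfolding section_inner_def section_norm2_def of_real_sum complex_norm_square by (rule refl)

lemma section_norm2_nonneg [simp]: "section_norm2 X y \<ge> 0"
  by (simp add: section_norm2_def sum_nonneg)

lemma section_Cauchy_Schwarz:
  "(cmod (section_inner X y x))\<^sup>2 \<le> section_norm2 X y * section_norm2 X x"
proof -
  have "cmod (section_inner X y x) \<le> (\<Sum>n\<in>{1..X}. cmod (y n) * cmod (x n))"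
    unfolding section_inner_def by (rule order.trans[OF norm_sum]) (simp add: norm_mult)
  then have "(cmod (section_inner X y x))\<^sup>2 \<le> (\<Sum>n\<in>{1..X}. cmod (y n) * cmod (x n))\<^sup>2"
    by (rule power_mono) simp
  also have "\<dots> \<le> section_norm2 X y * section_norm2 X x"
    unfolding section_norm2_def by (rule Cauchy_Schwarz_ineq_sum)
  finally show ?thesis .
qed

lemma section_inner_adjoint:
  "section_inner X y (dirichlet_prod a x) = section_inner X (dirichlet_adjoint a X y) x"
proof -
  have "section_inner X y (dirichlet_prod a x) =
      (\<Sum>n\<in>{1..X}. \<Sum>k\<in>{1..X}. y n * cnj (dirichlet_matrix a n k) * cnj (x k))"
    unfolding section_inner_def
    by (intro sum.cong refl) (simp add: dirichlet_prod_eq_matrix[of _ X] sum_distrib_left mult_ac del: atLeastAtMost_iff)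
  also have "\<dots> = (\<Sum>k\<in>{1..X}. \<Sum>n\<in>{1..X}. y n * cnj (dirichlet_matrix a n k) * cnj (x k))"
    by (rule sum.swap)
  also have "\<dots> = section_inner X (dirichlet_adjoint a X y) x"
    unfolding section_inner_def
    by (intro sum.cong refl) (simp add: dirichlet_adjoint_def sum_distrib_left sum_distrib_right mult_ac)
  finally show ?thesis .
qed

lemma section_inner_adjoint_power:
  "section_inner X y ((mult_op a ^^ n) x) = section_inner X ((dirichlet_adjoint a X ^^ n) y) x"
proof (induction n arbitrary: y)
  case (Suc n)
  have "section_inner X y ((mult_op a ^^ Suc n) x) = section_inner X (dirichlet_adjoint a X y) ((mult_op a ^^ n) x)"
    by (simp add: mult_op_def section_inner_adjoint)
  then show ?case by (simp only: Suc.IH funpow_Suc_right o_apply)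
qed simp

lemma section_norm2_adjoint_le:
  assumes "\<And>x. section_norm2 X (dirichlet_prod a x) \<le> section_norm2 X x"
  shows "section_norm2 X (dirichlet_adjoint a X y) \<le> section_norm2 X y"
proof -
  define z where "z = dirichlet_adjoint a X y"
  have "(section_norm2 X z)\<^sup>2 = (cmod (section_inner X y (dirichlet_prod a z)))\<^sup>2"
    unfolding section_inner_adjoint z_def[symmetric] section_inner_self by simp
  also have "\<dots> \<le> section_norm2 X y * section_norm2 X (dirichlet_prod a z)"
    by (rule section_Cauchy_Schwarz)
  also have "\<dots> \<le> section_norm2 X y * section_norm2 X z"
    by (intro mult_left_mono assms) simp
  finally have "section_norm2 X z * section_norm2 X z \<le> section_norm2 X y * section_norm2 X z"
    by (simp add: power2_eq_square)
  then show ?thesis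
    unfolding z_def[symmetric] by (cases "section_norm2 X z = 0") (auto simp: less_le)
qed

text \<open>
  The \<open>D i\<close> are the columns of a Cholesky factor of \<open>I - T T*\<close>. They take the place of the vectors
  \<open>(I - T T*)\<^sup>1\<^sup>/\<^sup>2 e\<^sub>i\<close>. Being triangular, the factor needs only finitely many columns for each
  \<open>X\<close>.
\<close>

lemma defect_vectors:
  assumes "\<And>X x. section_norm2 X (dirichlet_prod a x) \<le> section_norm2 X x"
  obtains D :: "nat \<Rightarrow> dirichlet_series"
  where "\<And>i n. n < i \<Longrightarrow> D i n = 0" "\<And>i. D i 0 = 0"
    "\<And>X y. (\<Sum>i\<le>X. (cmod (section_inner X y (D i)))\<^sup>2) = section_norm2 X y - section_norm2 X (dirichlet_adjoint a X y)"
proof -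
  define t where "t = dirichlet_matrix a"
  define K where "K = (\<lambda>n m. if n = 0 \<or> m = 0 then 0 else
     (if n = m then 1 else 0) - (\<Sum>k\<in>{1..n}. t n k * cnj (t m k)))"
  have K: "K n m = (if n = m then 1 else 0) - (\<Sum>k\<in>{1..X}. t n k * cnj (t m k))"
    if "n \<in> {1..X}" "m \<in> {1..X}" for n m X
  proof -
    have "(\<Sum>k\<in>{1..n}. t n k * cnj (t m k)) = (\<Sum>k\<in>{1..X}. t n k * cnj (t m k))"
      by (rule sum.mono_neutral_left) (use that in \<open>auto simp: t_def dirichlet_matrix_lower\<close>)
    then show ?thesis using that by (simp add: K_def)
  qed
  have form: "kernel_form K X y = of_real (section_norm2 X y - section_norm2 X (dirichlet_adjoint a X y))" for X y
  proof -
    have "kernel_form K X y = (\<Sum>n\<in>{1..X}. \<Sum>m\<in>{1..X}. cnj (y n) * K n m * y m)"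
      unfolding kernel_form_def
      by (intro sum.mono_neutral_cong_right) (auto simp: K_def not_le intro!: sum.mono_neutral_cong_right sum.neutral)
    also have "\<dots> = (\<Sum>n\<in>{1..X}. \<Sum>m\<in>{1..X}. (if n = m then cnj (y n) * y m else 0) -
        (\<Sum>k\<in>{1..X}. cnj (y n) * t n k * (cnj (t m k) * y m)))"
      by (intro sum.cong refl) (simp only: K, simp add: algebra_simps sum_distrib_left)
    also have "\<dots> = (\<Sum>n\<in>{1..X}. y n * cnj (y n)) -
        (\<Sum>n\<in>{1..X}. \<Sum>m\<in>{1..X}. \<Sum>k\<in>{1..X}. cnj (y n) * t n k * (cnj (t m k) * y m))"
      by (simp add: sum_subtractf sum.delta mult.commute)
    also have "(\<Sum>n\<in>{1..X}. \<Sum>m\<in>{1..X}. \<Sum>k\<in>{1..X}. cnj (y n) * t n k * (cnj (t m k) * y m)) =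
        (\<Sum>k\<in>{1..X}. \<Sum>n\<in>{1..X}. \<Sum>m\<in>{1..X}. cnj (y n) * t n k * (cnj (t m k) * y m))"
      by (subst (2) sum.swap, subst sum.swap) (rule refl)
    also have "\<dots> = (\<Sum>k\<in>{1..X}. dirichlet_adjoint a X y k * cnj (dirichlet_adjoint a X y k))"
      unfolding sum_product[symmetric]
      by (intro sum.cong refl) (simp add: dirichlet_adjoint_def t_def mult.commute)
    also have "(\<Sum>n\<in>{1..X}. y n * cnj (y n)) - \<dots> =
        of_real (section_norm2 X y) - of_real (section_norm2 X (dirichlet_adjoint a X y))"
      unfolding section_inner_self[symmetric] section_inner_def by (rule refl)
    finally show ?thesis by simp
  qed
  have pos: "positive_kernel K"
    unfolding positive_kernel_def
  proof (intro conjI allI)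
    show "K m n = cnj (K n m)" for n m
    proof (cases "n = 0 \<or> m = 0")
      case False
      then show ?thesis using K[of n "max n m" m] K[of m "max n m" n] by (simp add: mult.commute)
    qed (auto simp: K_def)
    show "0 \<le> Re (kernel_form K N c)" for N c
      unfolding form using section_norm2_adjoint_le[OF assms] by simp
  qed
  obtain D where D: "\<And>k n. n < k \<Longrightarrow> D k n = 0"
    "\<And>N n m. n \<le> N \<Longrightarrow> K n m = (\<Sum>k\<le>N. D k n * cnj (D k m))"
    using positive_kernel_cholesky[OF pos] by metis
  show thesis
  proof
    show "D i n = 0" if "n < i" for i n using D(1) that .
    show D0: "D i 0 = 0" for i
    proof -
      have "(\<Sum>k\<le>i. of_real ((cmod (D k 0))\<^sup>2)) = (0 :: complex)"
        unfolding complex_norm_square using D(2)[of 0 i 0] by (simp add: K_def)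
      then have "(\<Sum>k\<le>i. (cmod (D k 0))\<^sup>2) = 0" unfolding of_real_sum[symmetric] of_real_eq_0_iff .
      then show ?thesis by (subst (asm) sum_nonneg_eq_0_iff) auto
    qed
    fix X y
    have "of_real (\<Sum>i\<le>X. (cmod (section_inner X y (D i)))\<^sup>2) =
        (\<Sum>i\<le>X. \<Sum>n\<in>{1..X}. \<Sum>m\<in>{1..X}. cnj (y n) * (D i n * cnj (D i m)) * y m)"
      unfolding of_real_sum complex_norm_square
    proof (intro sum.cong refl)
      fix i
      show "section_inner X y (D i) * cnj (section_inner X y (D i)) =
        (\<Sum>n\<in>{1..X}. \<Sum>m\<in>{1..X}. cnj (y n) * (D i n * cnj (D i m)) * y m)"
        unfolding section_inner_def cnj_sum sum_product by (subst sum.swap) (simp add: mult_ac)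
    qed
    also have "\<dots> = (\<Sum>n\<in>{1..X}. \<Sum>m\<in>{1..X}. \<Sum>i\<le>X. cnj (y n) * (D i n * cnj (D i m)) * y m)"
      by (subst sum.swap, subst (2) sum.swap) (rule refl)
    also have "\<dots> = (\<Sum>n\<in>{1..X}. \<Sum>m\<in>{1..X}. cnj (y n) * K n m * y m)"
      by (intro sum.cong refl) (simp add: D(2)[of _ X] sum_distrib_left sum_distrib_right)
    also have "\<dots> = kernel_form K X y"
      unfolding kernel_form_def
      by (intro sum.mono_neutral_cong_left) (auto simp: K_def not_le intro!: sum.mono_neutral_cong_left sum.neutral)
    finally show "(\<Sum>i\<le>X. (cmod (section_inner X y (D i)))\<^sup>2) =
        section_norm2 X y - section_norm2 X (dirichlet_adjoint a X y)"
      unfolding form of_real_eq_iff .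
  qed
qed

section \<open>Parseval frames of orbits of contractions\<close>

lemma perturbed_geometric_null:
  fixes z r :: "nat \<Rightarrow> complex"
  assumes rec: "\<And>n. z (Suc n) = c * z n + r n" and c: "cmod c < 1" and r: "r \<longlonglongrightarrow> 0"
  shows "z \<longlonglongrightarrow> 0"
proof (rule LIMSEQ_I)
  fix e :: real assume e: "e > 0"
  define h where "h = e / 2"
  define d where "d = h * (1 - cmod c)"
  have "h > 0" "d > 0" using e c by (simp_all add: d_def h_def)
  then obtain N where N: "\<And>n. n \<ge> N \<Longrightarrow> cmod (r n) < d"
    using LIMSEQ_D[OF r] by force
  have bound: "cmod (z (N + k)) \<le> cmod c ^ k * cmod (z N) + h" for k
  proof (induction k)
    case (Suc k)
    have "cmod (z (N + Suc k)) \<le> cmod c * cmod (z (N + k)) + d"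
      using norm_triangle_ineq[of "c * z (N + k)" "r (N + k)"] N[of "N + k"] by (simp add: rec norm_mult)
    also have "\<dots> \<le> cmod c * (cmod c ^ k * cmod (z N) + h) + d"
      using Suc.IH by (intro add_right_mono mult_left_mono) auto
    also have "\<dots> = cmod c ^ Suc k * cmod (z N) + h"
      by (simp add: d_def algebra_simps)
    finally show ?case .
  qed (use \<open>h > 0\<close> in simp)
  have "(\<lambda>k. cmod c ^ k * cmod (z N)) \<longlonglongrightarrow> 0"
    using c by (intro tendsto_mult_left_zero LIMSEQ_power_zero) simp
  then obtain M where M: "\<And>k. k \<ge> M \<Longrightarrow> cmod c ^ k * cmod (z N) < h"
    using \<open>h > 0\<close> LIMSEQ_D[of _ 0 h] by force
  show "\<exists>n0. \<forall>n\<ge>n0. norm (z n - 0) < e"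
  proof (intro exI allI impI)
    fix n assume "n \<ge> N + M"
    then have "n = N + (n - N)" "n - N \<ge> M" by auto
    then show "norm (z n - 0) < e" using bound[of "n - N"] M[of "n - N"] by (simp add: h_def)
  qed
qed

text \<open>
  Coordinate \<open>k\<close> of \<open>T* z\<close> is \<open>cnj (a 1) * z k\<close> plus a combination of coordinates \<open>z m\<close> with \<open>m > k\<close>, so
  the coordinates tend to \<open>0\<close> one after the other, starting with the last.
\<close>

lemma adjoint_powers_null:
  assumes a1: "cmod (a 1) < 1"
  shows "(\<lambda>n. section_norm2 X ((dirichlet_adjoint a X ^^ n) y)) \<longlonglongrightarrow> 0"
proof -
  define z where "z = (\<lambda>n. (dirichlet_adjoint a X ^^ n) y)"
  have "(\<lambda>n. z n k) \<longlonglongrightarrow> 0" if "k \<in> {1..X}" for k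
    using that
  proof (induction "X - k" arbitrary: k rule: less_induct)
    case less
    define r where "r = (\<lambda>n. \<Sum>m\<in>{1..X} - {k}. cnj (dirichlet_matrix a m k) * z n m)"
    show ?case
    proof (rule perturbed_geometric_null)
      show "z (Suc n) k = cnj (a 1) * z n k + r n" for n
      proof -
        have "z (Suc n) k = (\<Sum>m\<in>{1..X}. cnj (dirichlet_matrix a m k) * z n m)"
          using less.prems by (simp add: z_def dirichlet_adjoint_def)
        also have "\<dots> = cnj (dirichlet_matrix a k k) * z n k + r n"
          unfolding r_def by (rule sum.remove) (use less.prems in auto)
        finally show ?thesis using less.prems by (simp add: dirichlet_matrix_diag)
      qed
      show "cmod (cnj (a 1)) < 1" using a1 by simp
      have "(\<lambda>n. cnj (dirichlet_matrix a m k) * z n m) \<longlonglongrightarrow> 0" if m: "m \<in> {1..X} - {k}" for m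
      proof (cases "m < k")
        case True
        then show ?thesis using m by (simp add: dirichlet_matrix_lower)
      next
        case False
        then have "(\<lambda>n. z n m) \<longlonglongrightarrow> 0" using m less.prems by (intro less.hyps) auto
        then show ?thesis by (rule tendsto_mult_right_zero)
      qed
      then have "r \<longlonglongrightarrow> (\<Sum>m\<in>{1..X} - {k}. 0)"
        unfolding r_def by (intro tendsto_sum)
      then show "r \<longlonglongrightarrow> 0" by simp
    qed
  qed
  then have "(\<lambda>n. \<Sum>k\<in>{1..X}. (cmod (z n k))\<^sup>2) \<longlonglongrightarrow> (\<Sum>k\<in>{1..X}. (cmod 0)\<^sup>2)"
    by (intro tendsto_sum tendsto_power tendsto_norm)
  then show ?thesis by (simp add: section_norm2_def z_def)
qed

text \<open>
  Telescoping of \<open>\<parallel>T*\<^sup>n y\<parallel>\<^sup>2 - \<parallel>T*\<^sup>n\<^sup>+\<^sup>1 y\<parallel>\<^sup>2\<close>, which is the contribution of the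
  \<open>n\<close>-th powers.
\<close>

lemma section_parseval:
  assumes contr: "\<And>x. section_norm2 X (dirichlet_prod a x) \<le> section_norm2 X x"
    and a1: "cmod (a 1) < 1"
    and D0: "\<And>i n. n < i \<Longrightarrow> D i n = 0"
    and D: "\<And>y. (\<Sum>i\<le>X. (cmod (section_inner X y (D i)))\<^sup>2) = section_norm2 X y - section_norm2 X (dirichlet_adjoint a X y)"
  shows "((\<lambda>j. (cmod (section_inner X y (orbit_family (mult_op a) D j)))\<^sup>2) has_sum section_norm2 X y) (UNIV \<times> UNIV)"
proof -
  define z where "z = (\<lambda>n. (dirichlet_adjoint a X ^^ n) y)"
  define u where "u = (\<lambda>n. section_norm2 X (z n))"
  define g where "g = (\<lambda>(n, i). (cmod (section_inner X (z n) (D i)))\<^sup>2)"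
  have inner: "((\<lambda>i. g (n, i)) has_sum u n - u (Suc n)) UNIV" for n
  proof (rule has_sum_finite_neutralI[of "{..X}"])
    show "g (n, i) = 0" if "i \<in> UNIV - {..X}" for i
      using that by (auto simp: g_def section_inner_def D0)
    show "u n - u (Suc n) = (\<Sum>i\<le>X. g (n, i))"
      using D[of "z n"] by (simp add: g_def u_def z_def)
  qed auto
  have u: "u \<longlonglongrightarrow> 0" unfolding u_def z_def by (rule adjoint_powers_null[of a, OF a1])
  have "u (Suc n) \<le> u n" for n
    unfolding u_def z_def using section_norm2_adjoint_le[OF contr] by simp
  then have outer: "((\<lambda>n. u n - u (Suc n)) has_sum u 0) UNIV"
    using telescope_sums'[OF u] by (intro sums_nonneg_imp_has_sum) auto
  have "(g has_sum u 0) (UNIV \<times> UNIV)"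
  proof (rule has_sum_SigmaI[OF inner outer])
    show "g summable_on UNIV \<times> UNIV"
      by (rule summable_on_SigmaI[OF inner has_sum_imp_summable[OF outer]]) (simp add: g_def)
  qed
  also have "?this \<longleftrightarrow> ?thesis"
    by (rule has_sum_reindex_bij_witness[of _ prod.swap prod.swap])
       (auto simp: g_def u_def z_def orbit_family_def section_inner_adjoint_power)
  finally show ?thesis .
qed

lemma section_norm2_eq_lessThan:
  assumes "x 0 = 0" shows "section_norm2 X x = (\<Sum>n<Suc X. (cmod (x n))\<^sup>2)"
  unfolding section_norm2_def by (rule sum.mono_neutral_cong_left) (use assms in \<open>auto simp: Suc_le_eq\<close>)

lemma H2_norm2: "x \<in> H2 \<Longrightarrow> (H2_norm x)\<^sup>2 = (\<Sum>n. (cmod (x n))\<^sup>2)"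
  unfolding H2_norm_def H2_def by (simp add: suminf_nonneg)

lemma section_norm2_tendsto:
  assumes "x \<in> H2" shows "(\<lambda>X. section_norm2 X x) \<longlonglongrightarrow> (H2_norm x)\<^sup>2"
  using assms LIMSEQ_Suc[OF summable_LIMSEQ[of "\<lambda>n. (cmod (x n))\<^sup>2"]]
  by (simp only: H2_norm2 section_norm2_eq_lessThan H2_def mem_Collect_eq)

lemma section_norm2_mono: "X \<le> Y \<Longrightarrow> section_norm2 X x \<le> section_norm2 Y x"
  unfolding section_norm2_def by (rule sum_mono2) auto

lemma section_norm2_le_H2_norm: "x \<in> H2 \<Longrightarrow> section_norm2 X x \<le> (H2_norm x)\<^sup>2"
  by (rule LIMSEQ_le_const[OF section_norm2_tendsto]) (auto intro!: section_norm2_mono exI[of _ X])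

lemma H2_memI:
  assumes "x 0 = 0" "\<And>X. section_norm2 X x \<le> B"
  shows "x \<in> H2"
proof -
  have "summable (\<lambda>n. (cmod (x n))\<^sup>2)"
  proof (rule summableI_nonneg_bounded)
    show "(\<Sum>n<N. (cmod (x n))\<^sup>2) \<le> B" for N
    proof -
      have "(\<Sum>n<N. (cmod (x n))\<^sup>2) \<le> (\<Sum>n<Suc N. (cmod (x n))\<^sup>2)" by simp
      also have "\<dots> = section_norm2 N x" by (rule section_norm2_eq_lessThan[of x, OF assms(1), symmetric])
      finally show ?thesis using assms(2)[of N] by simp
    qed
  qed simp
  then show ?thesis using assms(1) by (simp add: H2_def)
qed

lemma section_inner_tendsto:
  assumes y: "y \<in> H2" and x: "x \<in> H2"
  shows "(\<lambda>X. section_inner X y x) \<longlonglongrightarrow> H2_inner y x" "summable (\<lambda>n. y n * cnj (x n))"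
proof -
  have "summable (\<lambda>n. (cmod (y n))\<^sup>2 + (cmod (x n))\<^sup>2)"
    using y x by (intro summable_add) (auto simp: H2_def)
  then show s: "summable (\<lambda>n. y n * cnj (x n))"
  proof (rule summable_comparison_test')
    fix n
    show "norm (y n * cnj (x n)) \<le> (cmod (y n))\<^sup>2 + (cmod (x n))\<^sup>2"
    proof -
      have "0 \<le> cmod (y n) * cmod (x n)" by simp
      then show ?thesis
        using sum_squares_bound[of "cmod (y n)" "cmod (x n)"]
        unfolding norm_mult complex_mod_cnj by linarith
    qed
  qed
  have "section_inner X y x = (\<Sum>n<Suc X. y n * cnj (x n))" for X
    unfolding section_inner_def
    by (rule sum.mono_neutral_cong_left) (use y in \<open>auto simp: H2_def Suc_le_eq\<close>)
  then show "(\<lambda>X. section_inner X y x) \<longlonglongrightarrow> H2_inner y x"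
    unfolding H2_inner_def using LIMSEQ_Suc[OF summable_LIMSEQ[OF s]] by simp
qed

definition truncation :: "nat \<Rightarrow> dirichlet_series \<Rightarrow> dirichlet_series" where
  "truncation X y n = (if n \<in> {1..X} then y n else 0)"

lemma truncation_H2: "truncation X y \<in> H2"
  unfolding H2_def by (auto simp: truncation_def intro!: summable_finite[of "{1..X}"])

lemma H2_inner_truncation: "H2_inner (truncation X y) x = section_inner X y x"
  unfolding H2_inner_def section_inner_def
  by (subst suminf_finite[of "{1..X}"]) (auto simp: truncation_def intro!: sum.cong)

lemma H2_norm_truncation: "(H2_norm (truncation X y))\<^sup>2 = section_norm2 X y"
  unfolding H2_norm2[OF truncation_H2] section_norm2_def
  by (subst suminf_finite[of "{1..X}"]) (auto simp: truncation_def intro!: sum.cong)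

lemma H2_tail:
  assumes "y \<in> H2"
  shows "(\<lambda>n. y n - truncation X y n) \<in> H2"
    "(H2_norm (\<lambda>n. y n - truncation X y n))\<^sup>2 = (H2_norm y)\<^sup>2 - section_norm2 X y"
proof -
  have eq: "(cmod (y n - truncation X y n))\<^sup>2 = (cmod (y n))\<^sup>2 - (cmod (truncation X y n))\<^sup>2" for n
    by (simp add: truncation_def)
  have s: "summable (\<lambda>n. (cmod (y n))\<^sup>2)" "summable (\<lambda>n. (cmod (truncation X y n))\<^sup>2)"
    using assms truncation_H2[of X y] by (auto simp: H2_def)
  show w: "(\<lambda>n. y n - truncation X y n) \<in> H2"
    using assms summable_diff[OF s] unfolding H2_def mem_Collect_eq eq by (simp add: truncation_def)
  show "(H2_norm (\<lambda>n. y n - truncation X y n))\<^sup>2 = (H2_norm y)\<^sup>2 - section_norm2 X y"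
    unfolding H2_norm2[OF w] eq suminf_diff[OF s, symmetric]
    unfolding H2_norm2[OF assms] H2_norm_truncation[symmetric] H2_norm2[OF truncation_H2] by (rule refl)
qed

text \<open>
  A substitute for the triangle inequality in \<open>l\<^sup>2\<close> of the index set that can be summed term by term.
\<close>

lemma norm_add_square_le:
  fixes u v :: "'a :: real_normed_vector"
  assumes "\<eta> > 0"
  shows "(norm (u + v))\<^sup>2 \<le> (1 + \<eta>) * (norm u)\<^sup>2 + (1 + 1 / \<eta>) * (norm v)\<^sup>2"
proof -
  have "(norm (u + v))\<^sup>2 \<le> (norm u + norm v)\<^sup>2"
    by (intro power_mono norm_triangle_ineq) simp
  moreover have "0 \<le> (\<eta> * norm u - norm v)\<^sup>2 / \<eta>" using assms by simp
  moreover have "(\<eta> * norm u - norm v)\<^sup>2 / \<eta> = \<eta> * (norm u)\<^sup>2 + (norm v)\<^sup>2 / \<eta> - 2 * norm u * norm v"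
    using assms by (simp add: power2_eq_square field_simps)
  ultimately show ?thesis by (simp add: power2_sum algebra_simps)
qed

text \<open>
  The upper bound holds for finite subfamilies by continuity, which gives Bessel's inequality for all
  of \<open>H2\<close>. For the lower bound, the truncation of \<open>y\<close> at \<open>X\<close> satisfies Parseval's identity, and the
  error made by truncating is controlled by Bessel's inequality for the tail of \<open>y\<close>.
\<close>

lemma parseval_by_density:
  assumes x: "\<And>j. j \<in> J \<Longrightarrow> x j \<in> H2"
    and fin: "\<And>X y. ((\<lambda>j. (cmod (section_inner X y (x j)))\<^sup>2) has_sum section_norm2 X y) J"
    and y: "y \<in> H2"
  shows "((\<lambda>j. (cmod (H2_inner y (x j)))\<^sup>2) has_sum (H2_norm y)\<^sup>2) J"
proof -
  have upper: "(\<Sum>j\<in>F. (cmod (H2_inner y (x j)))\<^sup>2) \<le> (H2_norm y)\<^sup>2"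
    if F: "finite F" "F \<subseteq> J" and y: "y \<in> H2" for F y
  proof (rule LIMSEQ_le)
    show "(\<lambda>X. \<Sum>j\<in>F. (cmod (section_inner X y (x j)))\<^sup>2) \<longlonglongrightarrow> (\<Sum>j\<in>F. (cmod (H2_inner y (x j)))\<^sup>2)"
      using F y x by (intro tendsto_intros section_inner_tendsto) auto
    show "(\<lambda>X. section_norm2 X y) \<longlonglongrightarrow> (H2_norm y)\<^sup>2" by (rule section_norm2_tendsto[OF y])
    show "\<exists>N. \<forall>n\<ge>N. (\<Sum>j\<in>F. (cmod (section_inner n y (x j)))\<^sup>2) \<le> section_norm2 n y"
      by (intro exI allI impI finite_sum_le_has_sum[OF fin F]) simp
  qed
  have summ: "(\<lambda>j. (cmod (H2_inner y (x j)))\<^sup>2) summable_on J" if "y \<in> H2" for y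
    by (rule nonneg_bdd_above_summable_on) (use upper that in \<open>auto intro!: bdd_aboveI2[of _ _ "(H2_norm y)\<^sup>2"]\<close>)
  have bessel: "(\<Sum>\<^sub>\<infinity>j\<in>J. (cmod (H2_inner y (x j)))\<^sup>2) \<le> (H2_norm y)\<^sup>2" if "y \<in> H2" for y
    by (rule infsum_le_finite_sums[OF summ upper]) (use that in auto)
  define S where "S = (\<Sum>\<^sub>\<infinity>j\<in>J. (cmod (H2_inner y (x j)))\<^sup>2)"
  have lower: "(H2_norm y)\<^sup>2 \<le> (1 + \<eta>) * S" if \<eta>: "\<eta> > 0" for \<eta>
  proof (rule LIMSEQ_le)
    show "(\<lambda>X. section_norm2 X y) \<longlonglongrightarrow> (H2_norm y)\<^sup>2" by (rule section_norm2_tendsto[OF y])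
    have "(\<lambda>X. (1 + \<eta>) * S + (1 + 1 / \<eta>) * ((H2_norm y)\<^sup>2 - section_norm2 X y))
      \<longlonglongrightarrow> (1 + \<eta>) * S + (1 + 1 / \<eta>) * ((H2_norm y)\<^sup>2 - (H2_norm y)\<^sup>2)"
      by (intro tendsto_intros section_norm2_tendsto y)
    then show "(\<lambda>X. (1 + \<eta>) * S + (1 + 1 / \<eta>) * ((H2_norm y)\<^sup>2 - section_norm2 X y)) \<longlonglongrightarrow> (1 + \<eta>) * S"
      by simp
    have "section_norm2 X y \<le> (1 + \<eta>) * S + (1 + 1 / \<eta>) * ((H2_norm y)\<^sup>2 - section_norm2 X y)" for X
    proof -
      define w where "w = (\<lambda>n. y n - truncation X y n)"
      have w: "w \<in> H2" and wn: "(H2_norm w)\<^sup>2 = (H2_norm y)\<^sup>2 - section_norm2 X y"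
        unfolding w_def by (rule H2_tail[OF y])+
      have split: "section_inner X y (x j) = H2_inner y (x j) + - H2_inner w (x j)" if "j \<in> J" for j
      proof -
        have "H2_inner y (x j) - H2_inner w (x j) = (\<Sum>n. y n * cnj (x j n) - w n * cnj (x j n))"
          unfolding H2_inner_def
          by (rule suminf_diff) (use section_inner_tendsto(2) y w x that in auto)
        also have "\<dots> = H2_inner (truncation X y) (x j)"
          unfolding H2_inner_def w_def by (simp add: algebra_simps)
        finally show ?thesis by (simp add: H2_inner_truncation)
      qed
      have "section_norm2 X y = (\<Sum>\<^sub>\<infinity>j\<in>J. (cmod (section_inner X y (x j)))\<^sup>2)"
        by (rule infsumI[OF fin, symmetric])
      also have "\<dots> \<le> (\<Sum>\<^sub>\<infinity>j\<in>J. (1 + \<eta>) * (cmod (H2_inner y (x j)))\<^sup>2 + (1 + 1 / \<eta>) * (cmod (H2_inner w (x j)))\<^sup>2)"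
      proof (rule infsum_mono)
        show "(\<lambda>j. (cmod (section_inner X y (x j)))\<^sup>2) summable_on J"
          using fin by (rule has_sum_imp_summable)
        show "(\<lambda>j. (1 + \<eta>) * (cmod (H2_inner y (x j)))\<^sup>2 + (1 + 1 / \<eta>) * (cmod (H2_inner w (x j)))\<^sup>2) summable_on J"
          by (intro summable_on_add summable_on_cmult_right summ y w)
        show "(cmod (section_inner X y (x j)))\<^sup>2 \<le> (1 + \<eta>) * (cmod (H2_inner y (x j)))\<^sup>2 + (1 + 1 / \<eta>) * (cmod (H2_inner w (x j)))\<^sup>2"
          if "j \<in> J" for j
          unfolding split[OF that] using norm_add_square_le[OF \<eta>, of "H2_inner y (x j)" "- H2_inner w (x j)"] by simp
      qed
      also have "\<dots> = (1 + \<eta>) * S + (1 + 1 / \<eta>) * (\<Sum>\<^sub>\<infinity>j\<in>J. (cmod (H2_inner w (x j)))\<^sup>2)"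
        unfolding S_def
        by (subst infsum_add) (auto intro!: summable_on_cmult_right summ y w simp: infsum_cmult_right summ y w)
      also have "\<dots> \<le> (1 + \<eta>) * S + (1 + 1 / \<eta>) * ((H2_norm y)\<^sup>2 - section_norm2 X y)"
        using bessel[OF w] \<eta> unfolding wn by (intro add_left_mono mult_left_mono) auto
      finally show ?thesis .
    qed
    then show "\<exists>N. \<forall>n\<ge>N. section_norm2 n y \<le> (1 + \<eta>) * S + (1 + 1 / \<eta>) * ((H2_norm y)\<^sup>2 - section_norm2 n y)"
      by blast
  qed
  have "(H2_norm y)\<^sup>2 \<le> S"
  proof (rule tendsto_lowerbound)
    show "((\<lambda>\<eta>. (1 + \<eta>) * S) \<longlongrightarrow> S) (at_right 0)" by (auto intro!: tendsto_eq_intros)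
    show "\<forall>\<^sub>F \<eta> in at_right 0. (H2_norm y)\<^sup>2 \<le> (1 + \<eta>) * S"
      using lower by (auto simp: eventually_at_right_less intro: eventually_mono[OF eventually_at_right_less])
  qed simp
  then have "S = (H2_norm y)\<^sup>2" using bessel[OF y] by (simp add: S_def)
  then show ?thesis using has_sum_infsum[OF summ[OF y]] by (simp add: S_def)
qed

text \<open>
  The defect vectors lie in \<open>H2\<close> because their section norms \<open>\<nu>\<close> satisfy \<open>\<nu>\<^sup>2 \<le> \<nu>\<close>: test the
  defect identity on the vector itself.
\<close>

lemma contraction_parseval_frame_of_orbits:
  assumes contr: "\<And>X x. section_norm2 X (dirichlet_prod a x) \<le> section_norm2 X x"
    and a1: "cmod (a 1) < 1"
  shows "admits_parseval_frame_of_orbits (mult_op a)"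
proof -
  obtain D :: "nat \<Rightarrow> dirichlet_series"
    where D: "\<And>i n. n < i \<Longrightarrow> D i n = 0" "\<And>i. D i 0 = 0"
    "\<And>X y. (\<Sum>i\<le>X. (cmod (section_inner X y (D i)))\<^sup>2) = section_norm2 X y - section_norm2 X (dirichlet_adjoint a X y)"
    using defect_vectors[OF contr] by metis
  have DH2: "D i \<in> H2" for i
  proof (rule H2_memI[where x = "D i" and B = 1])
    show "D i 0 = 0" by (rule D(2))
    fix X
    define Y where "Y = max X i"
    define \<nu> where "\<nu> = section_norm2 Y (D i)"
    have "\<nu>\<^sup>2 = (cmod (section_inner Y (D i) (D i)))\<^sup>2"
      by (simp add: section_inner_self \<nu>_def)
    also have "\<dots> \<le> (\<Sum>j\<le>Y. (cmod (section_inner Y (D i) (D j)))\<^sup>2)"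
      by (rule member_le_sum) (auto simp: Y_def)
    also have "\<dots> \<le> \<nu>" unfolding D(3) \<nu>_def by simp
    finally have "\<nu> * \<nu> \<le> 1 * \<nu>" by (simp add: power2_eq_square)
    moreover have "\<nu> \<ge> 0" by (simp add: \<nu>_def)
    ultimately have "\<nu> \<le> 1" by (cases "\<nu> = 0") auto
    then show "section_norm2 X (D i) \<le> 1"
      using section_norm2_mono[of X Y "D i"] by (simp add: \<nu>_def Y_def)
  qed
  have orbit: "(mult_op a ^^ n) (D i) \<in> H2" for i n
  proof (induction n)
    case (Suc n)
    show ?case
    proof (rule H2_memI)
      show "section_norm2 X ((mult_op a ^^ Suc n) (D i)) \<le> (H2_norm ((mult_op a ^^ n) (D i)))\<^sup>2" for X
        using order.trans[OF contr section_norm2_le_H2_norm[OF Suc.IH]] by (simp add: mult_op_def)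
    qed (simp add: mult_op_def)
  qed (simp add: DH2)
  have "is_parseval_frame (UNIV \<times> UNIV) (orbit_family (mult_op a) D)"
    unfolding is_parseval_frame_def frame_with_bounds_def
  proof (intro conjI ballI)
    show "countable (UNIV \<times> UNIV :: (nat \<times> nat) set)" by simp
    show H2: "orbit_family (mult_op a) D j \<in> H2" for j
      using orbit by (cases j) (simp add: orbit_family_def)
    fix y assume "y \<in> H2"
    then have "((\<lambda>j. (cmod (H2_inner y (orbit_family (mult_op a) D j)))\<^sup>2) has_sum (H2_norm y)\<^sup>2) (UNIV \<times> UNIV)"
      by (intro parseval_by_density section_parseval contr a1 D H2)
    then show "(\<lambda>j. (cmod (H2_inner y (orbit_family (mult_op a) D j)))\<^sup>2) summable_on UNIV \<times> UNIV"
      "1 * (H2_norm y)\<^sup>2 \<le> (\<Sum>\<^sub>\<infinity>j\<in>UNIV \<times> UNIV. (cmod (H2_inner y (orbit_family (mult_op a) D j)))\<^sup>2)"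
      "(\<Sum>\<^sub>\<infinity>j\<in>UNIV \<times> UNIV. (cmod (H2_inner y (orbit_family (mult_op a) D j)))\<^sup>2) \<le> 1 * (H2_norm y)\<^sup>2"
      by (auto simp: infsumI intro: has_sum_imp_summable)
  qed
  then show ?thesis
    unfolding admits_parseval_frame_of_orbits_def parseval_frame_of_orbits_def
    using DH2 by (intro exI[of _ UNIV] exI[of _ D]) auto
qed

section \<open>Necessary conditions for a frame of orbits\<close>

lemma finite_section_frame_bounds:
  assumes "frame_with_bounds A B J x"
  shows "(\<lambda>j. (cmod (section_inner X y (x j)))\<^sup>2) summable_on J"
    "A * section_norm2 X y \<le> (\<Sum>\<^sub>\<infinity>j\<in>J. (cmod (section_inner X y (x j)))\<^sup>2)"
    "(\<Sum>\<^sub>\<infinity>j\<in>J. (cmod (section_inner X y (x j)))\<^sup>2) \<le> B * section_norm2 X y"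
  using assms truncation_H2[of X y] unfolding frame_with_bounds_def
  by (auto simp: H2_inner_truncation H2_norm_truncation dest!: bspec[of H2 _ "truncation X y"])

text \<open>
  The frame coefficients of \<open>T*\<^sup>n y\<close> are those of \<open>y\<close> along the shifted orbits, a subfamily of the
  frame coefficients of \<open>y\<close>.
\<close>

lemma adjoint_power_bounded_of_frame:
  assumes fr: "frame_with_bounds A B (I \<times> UNIV) (orbit_family (mult_op a) D)"
  shows "A * section_norm2 X ((dirichlet_adjoint a X ^^ n) y) \<le> B * section_norm2 X y"
proof -
  define h where "h = (\<lambda>j. (cmod (section_inner X y (orbit_family (mult_op a) D j)))\<^sup>2)"
  define shift where "shift = (\<lambda>(i :: 'a, m). (i, n + m))"
  have inj: "inj_on shift (I \<times> UNIV)" by (auto simp: shift_def inj_on_def)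
  have sub: "shift ` (I \<times> UNIV) \<subseteq> I \<times> UNIV" by (auto simp: shift_def)
  have summ: "h summable_on I \<times> UNIV"
    unfolding h_def by (rule finite_section_frame_bounds[OF fr])
  have "A * section_norm2 X ((dirichlet_adjoint a X ^^ n) y)
      \<le> (\<Sum>\<^sub>\<infinity>j\<in>I \<times> UNIV. (cmod (section_inner X ((dirichlet_adjoint a X ^^ n) y) (orbit_family (mult_op a) D j)))\<^sup>2)"
    by (rule finite_section_frame_bounds[OF fr])
  also have "\<dots> = infsum (h \<circ> shift) (I \<times> UNIV)"
    by (rule infsum_cong) (auto simp: h_def shift_def orbit_family_def funpow_add section_inner_adjoint_power)
  also have "\<dots> = infsum h (shift ` (I \<times> UNIV))" by (rule infsum_reindex[OF inj, symmetric])
  also have "\<dots> \<le> infsum h (I \<times> UNIV)"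
    by (rule infsum_mono_neutral) (use sub summ in \<open>auto simp: h_def intro: summable_on_subset_banach\<close>)
  also have "\<dots> \<le> B * section_norm2 X y"
    unfolding h_def by (rule finite_section_frame_bounds[OF fr])
  finally show ?thesis .
qed

definition dirichlet_one :: dirichlet_series where
  "dirichlet_one n = (if n = 1 then 1 else 0)"

lemma dirichlet_prod_one: "n > 0 \<Longrightarrow> dirichlet_prod a dirichlet_one n = a n"
  by (subst dirichlet_prod_eq_matrix[of _ n])
     (auto simp: dirichlet_one_def dirichlet_matrix_def if_distrib[of "\<lambda>x. _ * x"] sum.delta cong: if_cong)

text \<open>
  The \<open>k\<close>-th coefficient of \<open>T\<^sup>n 1\<close> is, up to conjugation, the first coordinate of \<open>T*\<^sup>n e\<^sub>k\<close>.
\<close>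

lemma power_coeff_bounded_of_frame:
  assumes fr: "frame_with_bounds A B (I \<times> UNIV) (orbit_family (mult_op a) D)" and "A > 0" and k: "k > 0"
  shows "(cmod ((mult_op a ^^ n) dirichlet_one k))\<^sup>2 \<le> B / A"
proof -
  define y :: dirichlet_series where "y = (\<lambda>m. if m = k then 1 else 0)"
  have y: "section_inner k y x = cnj (x k)" for x
    using k by (simp add: section_inner_def y_def if_distrib[of "\<lambda>x. x * _"] sum.delta cong: if_cong)
  have norms: "section_norm2 k y = 1" "section_norm2 k dirichlet_one = 1"
    using k by (simp_all add: section_norm2_def y_def dirichlet_one_def if_distrib[of cmod] if_distrib[of "\<lambda>x. x\<^sup>2"] sum.delta cong: if_cong)
  have "(cmod ((mult_op a ^^ n) dirichlet_one k))\<^sup>2 = (cmod (section_inner k ((dirichlet_adjoint a k ^^ n) y) dirichlet_one))\<^sup>2"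
    unfolding section_inner_adjoint_power[symmetric] y by simp
  also have "\<dots> \<le> section_norm2 k ((dirichlet_adjoint a k ^^ n) y) * section_norm2 k dirichlet_one"
    by (rule section_Cauchy_Schwarz)
  also have "\<dots> \<le> B / A"
    using adjoint_power_bounded_of_frame[OF fr, of k n y] \<open>A > 0\<close> by (simp add: norms field_simps)
  finally show ?thesis .
qed

lemma dirichlet_prod_at_1: "dirichlet_prod a x (Suc 0) = a (Suc 0) * x (Suc 0)"
  by (subst dirichlet_prod_eq_matrix[of _ 1]) (auto simp: dirichlet_matrix_def)

text \<open>
  The first coordinates along an orbit form a geometric sequence with ratio \<open>a 1\<close>. If this ratio has
  modulus at least \<open>1\<close>, square summability forces them all to vanish, and the frame does not see the
  first basis vector.
\<close>

lemma constant_term_of_frame: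
  assumes fr: "frame_with_bounds A B (I \<times> UNIV) (orbit_family (mult_op a) D)" and "A > 0"
  shows "cmod (a 1) < 1"
proof (rule ccontr)
  assume "\<not> cmod (a 1) < 1"
  then have a1: "cmod (a 1) \<ge> 1" by simp
  have pow: "(mult_op a ^^ n) x 1 = a 1 ^ n * x 1" for n x
    by (induction n) (simp_all add: mult_op_def dirichlet_prod_at_1)
  define h where "h = (\<lambda>j. (cmod (section_inner 1 dirichlet_one (orbit_family (mult_op a) D j)))\<^sup>2)"
  have h: "h (i, n) = (cmod (a 1) ^ n * cmod (D i 1))\<^sup>2" for i n
    using pow[of n "D i"] by (simp add: h_def section_inner_def dirichlet_one_def orbit_family_def norm_mult norm_power)
  have summ: "h summable_on I \<times> UNIV" and low: "A \<le> infsum h (I \<times> UNIV)"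
    using finite_section_frame_bounds(1,2)[OF fr, of 1 dirichlet_one]
    by (simp_all add: h_def section_norm2_def dirichlet_one_def)
  have "D i 1 = 0" if "i \<in> I" for i
  proof -
    have "h summable_on Pair i ` UNIV"
      by (rule summable_on_subset_banach[OF summ]) (use that in auto)
    then have "(\<lambda>n. h (i, n)) summable_on UNIV"
      by (subst (asm) summable_on_reindex) (auto simp: inj_on_def o_def)
    then have "summable (\<lambda>n. h (i, n))" by (rule summable_on_imp_summable)
    then have "(\<lambda>n. h (i, n)) \<longlonglongrightarrow> 0" by (rule summable_LIMSEQ_zero)
    moreover have "(cmod (D i 1))\<^sup>2 \<le> h (i, n)" for n
    proof -
      have "1 * cmod (D i 1) \<le> cmod (a 1) ^ n * cmod (D i 1)"
        by (intro mult_right_mono one_le_power a1) simp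
      then show ?thesis unfolding h by (intro power_mono) auto
    qed
    ultimately have "(cmod (D i 1))\<^sup>2 \<le> 0"
      by (intro LIMSEQ_le_const[where X = "\<lambda>n. h (i, n)"]) auto
    then show ?thesis by simp
  qed
  then have "infsum h (I \<times> UNIV) = 0" by (intro infsum_0) (auto simp: h)
  then show False using low \<open>A > 0\<close> by simp
qed

text \<open>
  The parameter is a set of admissible primes, and not a bound for them, so that primes can be
  adjoined one at a time.
\<close>

definition smooth_numbers :: "nat set \<Rightarrow> nat set" where
  "smooth_numbers P = {n. n > 0 \<and> (\<forall>q. prime q \<longrightarrow> q dvd n \<longrightarrow> q \<in> P)}"

text \<open>
  This is the convergence of the Euler product \<open>\<Prod>p\<in>P. 1 / (1 - p powr (-\<sigma>))\<close>: adding a prime \<open>p\<close> to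
  \<open>P\<close> amounts to multiplying by a geometric series.
\<close>

lemma smooth_numbers_powr_summable:
  assumes "finite P" "\<And>p. p \<in> P \<Longrightarrow> prime p" "\<sigma> > 0"
  shows "(\<lambda>n. real n powr (- \<sigma>)) summable_on smooth_numbers P"
  using assms(1,2)
proof (induction P rule: finite_induct)
  case empty
  have "smooth_numbers {} \<subseteq> {1}"
    unfolding smooth_numbers_def using prime_factor_nat by auto
  then show ?case by (intro summable_on_finite) (auto dest: finite_subset)
next
  case (insert p P)
  have p: "prime p" using insert.prems by simp
  define g where "g = (\<lambda>(k, m). p ^ k * m)"
  define q where "q = real p powr (- \<sigma>)"
  have p1: "real p > 1" using prime_gt_1_nat[OF p] by simp
  have q: "0 \<le> q" "q < 1" using p1 assms(3) by (auto simp: q_def powr_less_one)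
  have ndvd: "\<not> p dvd m" if "m \<in> smooth_numbers P" for m
    using that p insert.hyps by (auto simp: smooth_numbers_def)
  have img: "smooth_numbers (insert p P) \<subseteq> g ` (UNIV \<times> smooth_numbers P)"
  proof
    fix n assume n: "n \<in> smooth_numbers (insert p P)"
    obtain y where y: "n = p ^ multiplicity p n * y" "\<not> p dvd y"
      by (rule multiplicity_decompose'[of n p]) (use n p in \<open>auto simp: smooth_numbers_def\<close>)
    have "r \<in> P" if "prime r" "r dvd y" for r
    proof -
      have "r \<in> insert p P" using n that y(1) unfolding smooth_numbers_def by (metis (mono_tags, lifting) dvd_mult mem_Collect_eq)
      then show ?thesis using y(2) that by auto
    qed
    moreover have "y > 0" using y(2) by (auto intro: Nat.gr0I)
    ultimately have "y \<in> smooth_numbers P" by (auto simp: smooth_numbers_def)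
    then show "n \<in> g ` (UNIV \<times> smooth_numbers P)"
      unfolding g_def by (intro image_eqI[of _ _ "(multiplicity p n, y)"]) (use y(1) in auto)
  qed
  have inj: "inj_on g (UNIV \<times> smooth_numbers P)"
  proof (rule inj_onI, clarify)
    fix k m l m' assume mm: "m \<in> smooth_numbers P" "m' \<in> smooth_numbers P" and "g (k, m) = g (l, m')"
    then have eq: "p ^ k * m = p ^ l * m'" by (simp add: g_def)
    have "k = l"
      by (rule prime_power_cancel[of p m k m' l]) (use p eq ndvd mm in \<open>auto simp: mult.commute\<close>)
    then show "k = l \<and> m = m'" using eq p by (auto dest: prime_gt_0_nat)
  qed
  have "((\<lambda>n. real n powr (- \<sigma>)) \<circ> g) summable_on UNIV \<times> smooth_numbers P"
  proof (rule summable_on_SigmaI)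
    fix k
    have eq: "((\<lambda>n. real n powr (- \<sigma>)) \<circ> g) (k, m) = q ^ k * real m powr (- \<sigma>)" for m
      using p1 by (simp add: g_def q_def powr_mult powr_power flip: powr_realpow powr_powr) (simp add: powr_powr mult.commute)
    show "((\<lambda>m. ((\<lambda>n. real n powr (- \<sigma>)) \<circ> g) (k, m)) has_sum
        q ^ k * (\<Sum>\<^sub>\<infinity>m\<in>smooth_numbers P. real m powr (- \<sigma>))) (smooth_numbers P)"
      unfolding eq using insert by (intro has_sum_cmult_right has_sum_infsum) auto
  next
    show "(\<lambda>k. q ^ k * (\<Sum>\<^sub>\<infinity>m\<in>smooth_numbers P. real m powr (- \<sigma>))) summable_on UNIV"
      using q by (intro summable_on_cmult_left summable_nonneg_imp_summable_on summable_geometric) auto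
  qed (auto simp: o_def)
  then have "(\<lambda>n. real n powr (- \<sigma>)) summable_on g ` (UNIV \<times> smooth_numbers P)"
    by (subst summable_on_reindex[OF inj])
  then show ?case by (rule summable_on_subset_banach) (rule img)
qed

definition smooth_part :: "nat \<Rightarrow> dirichlet_series \<Rightarrow> dirichlet_series" where
  "smooth_part N a n = (if n \<in> smooth_numbers {p. prime p \<and> p \<le> N} then a n else 0)"

text \<open>
  A product is smooth exactly when both its factors are.
\<close>

lemma smooth_part_prod:
  "smooth_part N (dirichlet_prod a b) = dirichlet_prod (smooth_part N a) (smooth_part N b)"
proof
  fix n
  let ?S = "smooth_numbers {p. prime p \<and> p \<le> N}"
  have mult: "k * m \<in> ?S \<longleftrightarrow> k \<in> ?S \<and> m \<in> ?S" for k m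
    unfolding smooth_numbers_def by (auto simp: prime_dvd_mult_iff)
  show "smooth_part N (dirichlet_prod a b) n = dirichlet_prod (smooth_part N a) (smooth_part N b) n"
  proof (cases "n \<in> ?S")
    case True
    then show ?thesis unfolding smooth_part_def dirichlet_prod_def
      by (auto simp: mult intro!: sum.cong)
  next
    case False
    then show ?thesis unfolding smooth_part_def dirichlet_prod_def
      by (auto simp: mult intro!: sum.neutral)
  qed
qed

lemma smooth_part_power:
  "smooth_part N ((mult_op a ^^ j) dirichlet_one) = (mult_op (smooth_part N a) ^^ j) dirichlet_one"
proof (induction j)
  case 0
  have "(1 :: nat) \<in> smooth_numbers {p. prime p \<and> p \<le> N}" by (auto simp: smooth_numbers_def)
  then show ?case by (auto simp: smooth_part_def dirichlet_one_def)
qed (simp add: mult_op_def smooth_part_prod)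

text \<open>
  The \<open>j\<close>-th power of the sum is the sum of the \<open>j\<close>-th convolution power, whose coefficients are
  bounded by \<open>sqrt K\<close>. So all powers of the sum are bounded by one constant.
\<close>

lemma smooth_part_sum_le_1:
  assumes bd: "\<And>j n. n > 0 \<Longrightarrow> (cmod ((mult_op a ^^ j) dirichlet_one n))\<^sup>2 \<le> K" and \<sigma>: "\<sigma> > 0"
  shows "summable (\<lambda>n. cmod (smooth_part N a n) * real n powr (- \<sigma>))"
    "\<sigma> \<le> Re s \<Longrightarrow> cmod (dirichlet_sum (smooth_part N a) s) \<le> 1"
proof -
  let ?S = "smooth_numbers {p. prime p \<and> p \<le> N}"
  define b where "b = smooth_part N a"
  define w where "w = (\<lambda>n. if n \<in> ?S then sqrt K * real n powr (- \<sigma>) else 0)"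
  have w: "summable w"
  proof -
    have "(\<lambda>n. real n powr (- \<sigma>)) summable_on ?S"
      by (rule smooth_numbers_powr_summable[OF _ _ \<sigma>]) auto
    then have "(\<lambda>n. sqrt K * real n powr (- \<sigma>)) summable_on ?S" by (rule summable_on_cmult_right)
    also have "?this \<longleftrightarrow> w summable_on UNIV"
      by (rule summable_on_cong_neutral) (auto simp: w_def)
    finally show ?thesis by (rule summable_on_imp_summable)
  qed
  have pow: "cmod ((mult_op b ^^ j) dirichlet_one n) * real n powr (- \<sigma>) \<le> w n" for j n
  proof -
    have "cmod ((mult_op a ^^ j) dirichlet_one n) \<le> sqrt K" if "n \<in> ?S"
      using bd[of n j] that by (intro real_le_rsqrt) (auto simp: smooth_numbers_def)
    then show ?thesis
      unfolding b_def smooth_part_power[symmetric]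
      by (auto simp: w_def smooth_part_def intro!: mult_right_mono)
  qed
  have summ: "summable (\<lambda>n. cmod ((mult_op b ^^ j) dirichlet_one n) * real n powr (- \<sigma>))" for j
    by (rule summable_comparison_test'[OF w]) (use pow in auto)
  have b1: "cmod ((mult_op b ^^ 1) dirichlet_one n) * real n powr (- \<sigma>) = cmod (b n) * real n powr (- \<sigma>)" for n
    by (cases "n = 0") (auto simp: mult_op_def dirichlet_prod_one)
  have sb: "summable (\<lambda>n. cmod (b n) * real n powr (- \<sigma>))"
    using summ[of 1] unfolding b1 .
  then show "summable (\<lambda>n. cmod (smooth_part N a n) * real n powr (- \<sigma>))"
    by (simp add: b_def)
  assume s: "\<sigma> \<le> Re s"
  have mult: "dirichlet_sum ((mult_op b ^^ j) dirichlet_one) s = dirichlet_sum b s ^ j" for j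
  proof (induction j)
    case 0
    show ?case unfolding dirichlet_sum_def
      by (subst suminf_finite[of "{1}"]) (auto simp: dirichlet_one_def)
  next
    case (Suc j)
    have "dirichlet_sum ((mult_op b ^^ Suc j) dirichlet_one) s = dirichlet_sum b s * dirichlet_sum ((mult_op b ^^ j) dirichlet_one) s"
      unfolding funpow.simps o_apply mult_op_def[of b]
      by (intro dirichlet_sum_prod dirichlet_series_abs_summable[OF _ s] sb summ[unfolded mult_op_def])
    then show ?case by (simp add: Suc.IH)
  qed
  have "cmod (dirichlet_sum b s) ^ j \<le> suminf w" for j
  proof -
    have "cmod (dirichlet_sum b s) ^ j = cmod (dirichlet_sum ((mult_op b ^^ j) dirichlet_one) s)"
      by (simp add: mult norm_power)
    also have "\<dots> \<le> (\<Sum>n. cmod ((mult_op b ^^ j) dirichlet_one n * of_nat n powr (- s)))"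
      unfolding dirichlet_sum_def by (rule summable_norm) (rule dirichlet_series_abs_summable[OF summ s])
    also have "\<dots> \<le> suminf w"
      by (intro suminf_le w dirichlet_series_abs_summable[OF summ s] order.trans[OF cmod_dirichlet_term_le[OF s] pow])
    finally show ?thesis .
  qed
  then show "cmod (dirichlet_sum (smooth_part N a) s) \<le> 1"
    unfolding b_def[symmetric] using real_arch_pow[of "cmod (dirichlet_sum b s)" "suminf w"] by (meson not_less)
qed

text \<open>
  Far to the right the smooth parts converge to \<open>a\<close> by dominated convergence, and their uniform bound
  extends to the limit on the whole half-plane.
\<close>

lemma Hinf_sum_le_1:
  assumes a: "a \<in> Hinf"
    and bd: "\<And>j n. n > 0 \<Longrightarrow> (cmod ((mult_op a ^^ j) dirichlet_one n))\<^sup>2 \<le> K"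
    and s: "Re s > 0"
  shows "cmod (dirichlet_sum a s) \<le> 1"
proof -
  define \<sigma> where "\<sigma> = Re s / 2"
  have \<sigma>: "\<sigma> > 0" "\<sigma> < Re s" using s by (auto simp: \<sigma>_def)
  show ?thesis
  proof (rule bounded_limit_on_half_plane[where F = "\<lambda>N. dirichlet_sum (smooth_part N a)" and \<sigma> = \<sigma> and \<tau> = 3 and G = "dirichlet_sum a"])
    show "dirichlet_sum (smooth_part N a) holomorphic_on {s. \<sigma> < Re s}" for N
      by (rule dirichlet_sum_holomorphic[OF smooth_part_sum_le_1(1)[OF bd \<sigma>(1)]])
    show "cmod (dirichlet_sum (smooth_part N a) s) \<le> 1" if "\<sigma> < Re s" for N s
      by (rule smooth_part_sum_le_1(2)[OF bd \<sigma>(1)]) (use that in auto)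
    show "dirichlet_sum a holomorphic_on {s. \<sigma> < Re s}"
      by (rule holomorphic_on_subset[of _ right_half_plane]) (use a \<sigma> in \<open>auto simp: Hinf_def right_half_plane_def\<close>)
    fix s :: complex assume s: "3 < Re s"
    have "(\<lambda>N. \<Sum>n. smooth_part N a n * of_nat n powr (- s)) \<longlonglongrightarrow> (\<Sum>n. a n * of_nat n powr (- s))"
    proof (rule tannerys_theorem[THEN conjunct2, THEN conjunct2])
      show "(\<lambda>N. smooth_part N a n * of_nat n powr (- s)) \<longlonglongrightarrow> a n * of_nat n powr (- s)" for n
      proof (rule tendsto_eventually, rule eventually_sequentiallyI[of n])
        fix N assume "n \<le> N"
        then have "n \<in> smooth_numbers {p. prime p \<and> p \<le> N}" if "n > 0"
          using that by (auto simp: smooth_numbers_def dest!: dvd_imp_le)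
        then show "smooth_part N a n * of_nat n powr (- s) = a n * of_nat n powr (- s)"
          by (cases "n = 0") (auto simp: smooth_part_def)
      qed
      have "cmod (smooth_part N a n * of_nat n powr (- s)) \<le> cmod (a n) * real n powr (- 3)" for N n
        using cmod_dirichlet_term_le[of 3 s a n] s by (auto simp: smooth_part_def)
      then show "\<forall>\<^sub>F (n, N) in at_top \<times>\<^sub>F sequentially. cmod (smooth_part N a n * of_nat n powr (- s)) \<le> cmod (a n) * real n powr - 3"
        by (intro always_eventually) auto
      show "summable (\<lambda>n. cmod (a n) * real n powr (- 3))" by (rule Hinf_abs_summable[OF a])
    qed auto
    then show "(\<lambda>N. dirichlet_sum (smooth_part N a) s) \<longlonglongrightarrow> dirichlet_sum a s"
      by (simp add: dirichlet_sum_def)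
  qed (rule \<sigma>(2))
qed

section \<open>The number of orbits and the characterisation\<close>

text \<open>
  Each equation is imposed on the span of two solutions of the previous ones with disjoint supports;
  disjointness keeps the combination nonzero.
\<close>

lemma homogeneous_system_nontrivial_solution:
  fixes \<phi> :: "'e \<Rightarrow> nat \<Rightarrow> complex"
  assumes "finite E" "infinite P"
  shows "\<exists>c F. finite F \<and> F \<subseteq> P \<and> (\<forall>q. q \<notin> F \<longrightarrow> c q = 0) \<and> (\<exists>q\<in>F. c q \<noteq> 0) \<and>
    (\<forall>e\<in>E. (\<Sum>q\<in>F. c q * \<phi> e q) = 0)"
  using assms
proof (induction E arbitrary: P rule: finite_induct)
  case empty
  then obtain p where "p \<in> P" by (metis ex_in_conv finite.emptyI)
  then show ?case by (intro exI[of _ "\<lambda>q. if q = p then 1 else 0"] exI[of _ "{p}"]) auto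
next
  case (insert e E)
  obtain c F where c: "finite F" "F \<subseteq> P" "\<And>q. q \<notin> F \<Longrightarrow> c q = 0" "\<exists>q\<in>F. c q \<noteq> 0"
    "\<And>e. e \<in> E \<Longrightarrow> (\<Sum>q\<in>F. c q * \<phi> e q) = 0"
    using insert.IH[OF insert.prems] by blast
  obtain d G where d: "finite G" "G \<subseteq> P - F" "\<And>q. q \<notin> G \<Longrightarrow> d q = 0" "\<exists>q\<in>G. d q \<noteq> 0"
    "\<And>e. e \<in> E \<Longrightarrow> (\<Sum>q\<in>G. d q * \<phi> e q) = 0"
    using insert.IH[OF Diff_infinite_finite[OF c(1) insert.prems]] by blast
  define \<alpha> where "\<alpha> = (\<Sum>q\<in>F. c q * \<phi> e q)"
  define \<beta> where "\<beta> = (\<Sum>q\<in>G. d q * \<phi> e q)"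
  show ?case
  proof (cases "\<alpha> = 0")
    case True
    then show ?thesis using c by (intro exI[of _ c] exI[of _ F]) (auto simp: \<alpha>_def)
  next
    case False
    define h where "h = (\<lambda>q. \<beta> * c q - \<alpha> * d q)"
    have sum: "(\<Sum>q\<in>F \<union> G. h q * \<phi> e' q) = \<beta> * (\<Sum>q\<in>F. c q * \<phi> e' q) - \<alpha> * (\<Sum>q\<in>G. d q * \<phi> e' q)" for e'
    proof -
      have "(\<Sum>q\<in>F \<union> G. h q * \<phi> e' q) = \<beta> * (\<Sum>q\<in>F \<union> G. c q * \<phi> e' q) - \<alpha> * (\<Sum>q\<in>F \<union> G. d q * \<phi> e' q)"
        by (simp add: h_def sum_distrib_left sum_subtractf algebra_simps)
      also have "(\<Sum>q\<in>F \<union> G. c q * \<phi> e' q) = (\<Sum>q\<in>F. c q * \<phi> e' q)"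
        by (rule sum.mono_neutral_right) (use c d in auto)
      also have "(\<Sum>q\<in>F \<union> G. d q * \<phi> e' q) = (\<Sum>q\<in>G. d q * \<phi> e' q)"
        by (rule sum.mono_neutral_right) (use c d in auto)
      finally show ?thesis .
    qed
    obtain q where q: "q \<in> G" "d q \<noteq> 0" using d(4) by blast
    then have "h q \<noteq> 0" using False c(3)[of q] d(2) by (auto simp: h_def)
    show ?thesis
    proof (intro exI[of _ h] exI[of _ "F \<union> G"] conjI ballI)
      show "finite (F \<union> G)" "F \<union> G \<subseteq> P" using c(1,2) d(1,2) by auto
      show "\<forall>q. q \<notin> F \<union> G \<longrightarrow> h q = 0" using c(3) d(3) by (auto simp: h_def)
      show "\<exists>q\<in>F \<union> G. h q \<noteq> 0" using q(1) \<open>h q \<noteq> 0\<close> by blast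
      show "(\<Sum>q\<in>F \<union> G. h q * \<phi> e' q) = 0" if "e' \<in> insert e E" for e'
        using that by (auto simp: sum c(5) d(5) \<alpha>_def[symmetric] \<beta>_def[symmetric])
    qed
  qed
qed

lemma dirichlet_prod_at_prime:
  assumes "prime q"
  shows "dirichlet_prod a x q = a 1 * x q + a q * x 1"
proof -
  have q: "q > 1" using assms by (rule prime_gt_1_nat)
  have "dirichlet_prod a x q = (\<Sum>k\<in>{1..q}. dirichlet_matrix a q k * x k)"
    using q by (intro dirichlet_prod_eq_matrix) auto
  also have "\<dots> = (\<Sum>k\<in>{1, q}. dirichlet_matrix a q k * x k)"
    by (rule sum.mono_neutral_right) (use q assms in \<open>auto simp: dirichlet_matrix_def prime_nat_iff\<close>)
  also have "\<dots> = a 1 * x q + a q * x 1"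
    using q by (simp add: dirichlet_matrix_def)
  finally show ?thesis .
qed

text \<open>
  The vector \<open>c\<close> is supported on primes and satisfies one equation for each \<open>D i\<close>, and one more that
  cancels the first coordinate of \<open>T* c\<close> and so makes \<open>c\<close> an eigenvector of \<open>T*\<close>.
\<close>

lemma frame_of_orbits_infinite:
  assumes "frame_of_orbits (mult_op a) I D"
  shows "infinite I"
proof
  assume "finite I"
  obtain A B where "A > 0" and fr: "frame_with_bounds A B (I \<times> UNIV) (orbit_family (mult_op a) D)"
    using assms by (auto simp: frame_of_orbits_def is_frame_def)
  \<comment> \<open>The index \<open>None\<close> stands for the equation that makes \<open>c\<close> an eigenvector.\<close>
  define \<phi> where "\<phi> = (\<lambda>e q. case e of None \<Rightarrow> cnj (a q) | Some i \<Rightarrow> cnj (D i q))"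
  have "\<exists>c F. finite F \<and> F \<subseteq> {p :: nat. prime p} \<and> (\<forall>q. q \<notin> F \<longrightarrow> c q = 0) \<and> (\<exists>q\<in>F. c q \<noteq> 0) \<and>
      (\<forall>e\<in>insert None (Some ` I). (\<Sum>q\<in>F. c q * \<phi> e q) = 0)"
    by (rule homogeneous_system_nontrivial_solution) (use \<open>finite I\<close> primes_infinite in simp_all)
  then obtain c F where F: "finite F" "F \<subseteq> {p. prime p}" and c0: "\<And>q. q \<notin> F \<Longrightarrow> c q = 0" and nz: "\<exists>q\<in>F. c q \<noteq> 0"
    and eqs: "\<And>e. e \<in> insert None (Some ` I) \<Longrightarrow> (\<Sum>q\<in>F. c q * \<phi> e q) = 0"
    by metis
  define X where "X = Max (insert 0 F)"
  have FX: "F \<subseteq> {1..X}"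
    using F by (auto simp: X_def Suc_le_eq intro!: prime_gt_0_nat)
  have inner: "section_inner X c x = (\<Sum>q\<in>F. c q * cnj (x q))" for x
    unfolding section_inner_def by (rule sum.mono_neutral_right) (use FX c0 in auto)
  have a0: "(\<Sum>q\<in>F. c q * cnj (a q)) = 0" using eqs[of None] by (simp add: \<phi>_def)
  have D0: "section_inner X c (D i) = 0" if "i \<in> I" for i
    using eqs[of "Some i"] that by (simp add: \<phi>_def inner)
  have step: "section_inner X c (mult_op a x) = cnj (a 1) * section_inner X c x" for x
  proof -
    have "section_inner X c (mult_op a x) = (\<Sum>q\<in>F. cnj (a 1) * (c q * cnj (x q)) + cnj (x 1) * (c q * cnj (a q)))"
      unfolding inner
    proof (rule sum.cong[OF refl])
      fix q assume "q \<in> F"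
      then have "prime q" using F by auto
      then show "c q * cnj (mult_op a x q) = cnj (a 1) * (c q * cnj (x q)) + cnj (x 1) * (c q * cnj (a q))"
        by (simp add: mult_op_def dirichlet_prod_at_prime algebra_simps)
    qed
    also have "\<dots> = cnj (a 1) * section_inner X c x + cnj (x 1) * (\<Sum>q\<in>F. c q * cnj (a q))"
      by (simp add: sum.distrib sum_distrib_left inner)
    finally show ?thesis by (simp add: a0)
  qed
  have "section_inner X c ((mult_op a ^^ n) (D i)) = 0" if "i \<in> I" for i n
    by (induction n) (simp_all add: step D0 that)
  then have "(\<Sum>\<^sub>\<infinity>j\<in>I \<times> UNIV. (cmod (section_inner X c (orbit_family (mult_op a) D j)))\<^sup>2) = 0"
    by (intro infsum_0) (auto simp: orbit_family_def)
  then have "section_norm2 X c \<le> 0"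
    using finite_section_frame_bounds(2)[OF fr, of X c] \<open>A > 0\<close> by (simp add: mult_le_0_iff)
  moreover have "section_norm2 X c > 0"
  proof -
    obtain q where "q \<in> F" "c q \<noteq> 0" using nz by blast
    then show ?thesis unfolding section_norm2_def
      using FX by (intro sum_pos2[of _ q]) auto
  qed
  ultimately show False by simp
qed

lemma Hinf_norm_le_1_iff:
  assumes "a \<in> Hinf"
  shows "Hinf_norm a \<le> 1 \<longleftrightarrow> (\<forall>s. Re s > 0 \<longrightarrow> cmod (dirichlet_sum a s) \<le> 1)"
proof
  assume *: "Hinf_norm a \<le> 1"
  have "bounded (dirichlet_sum a ` right_half_plane)" using assms by (simp add: Hinf_def)
  then obtain B where "\<And>s. s \<in> right_half_plane \<Longrightarrow> cmod (dirichlet_sum a s) \<le> B"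
    by (auto simp: bounded_iff)
  then have "bdd_above ((\<lambda>s. cmod (dirichlet_sum a s)) ` right_half_plane)"
    by (rule bdd_aboveI2)
  then have "cmod (dirichlet_sum a s) \<le> Hinf_norm a" if "Re s > 0" for s
    unfolding Hinf_norm_def using that by (intro cSUP_upper) (auto simp: right_half_plane_def)
  then show "\<forall>s. Re s > 0 \<longrightarrow> cmod (dirichlet_sum a s) \<le> 1" using * by force
next
  assume "\<forall>s. Re s > 0 \<longrightarrow> cmod (dirichlet_sum a s) \<le> 1"
  moreover have "(1 :: complex) \<in> right_half_plane" by (simp add: right_half_plane_def)
  then have "right_half_plane \<noteq> {}" by blast
  ultimately show "Hinf_norm a \<le> 1"
    unfolding Hinf_norm_def by (intro cSUP_least) (auto simp: right_half_plane_def)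
qed

theorem theorem3p1:
  fixes D0 :: dirichlet_series
  assumes "D0 \<in> Hinf"
  shows "(admits_parseval_frame_of_orbits (mult_op D0) \<longleftrightarrow> admits_frame_of_orbits (mult_op D0)) \<and>
         (admits_frame_of_orbits (mult_op D0) \<longleftrightarrow> Hinf_norm D0 \<le> 1 \<and> cmod (D0 1) < 1) \<and>
         (admits_frame_of_orbits (mult_op D0) \<longrightarrow>
            (\<forall>(I :: 'i set) D. frame_of_orbits (mult_op D0) I D \<longrightarrow> infinite I))"
proof -
  let ?T = "mult_op D0"
  have i_ii: "admits_frame_of_orbits ?T" if "admits_parseval_frame_of_orbits ?T"
    using that zero_less_one
    unfolding admits_parseval_frame_of_orbits_def admits_frame_of_orbits_def parseval_frame_of_orbits_def
      frame_of_orbits_def is_parseval_frame_def is_frame_def by blast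
  have ii_iii: "Hinf_norm D0 \<le> 1 \<and> cmod (D0 1) < 1" if "admits_frame_of_orbits ?T"
  proof -
    obtain I :: "nat set" and D A B where A: "A > 0"
      and fr: "frame_with_bounds A B (I \<times> UNIV) (orbit_family ?T D)"
      using \<open>admits_frame_of_orbits ?T\<close> by (auto simp: admits_frame_of_orbits_def frame_of_orbits_def is_frame_def)
    have "cmod (dirichlet_sum D0 s) \<le> 1" if "Re s > 0" for s
      by (rule Hinf_sum_le_1[OF assms power_coeff_bounded_of_frame[OF fr A] that])
    then show ?thesis
      using constant_term_of_frame[OF fr A] Hinf_norm_le_1_iff[OF assms] by blast
  qed
  have iii_i: "admits_parseval_frame_of_orbits ?T" if iii: "Hinf_norm D0 \<le> 1 \<and> cmod (D0 1) < 1"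
  proof (rule contraction_parseval_frame_of_orbits)
    have "cmod (dirichlet_sum D0 s) \<le> 1" if "Re s > 0" for s
      using iii that Hinf_norm_le_1_iff[OF assms] by blast
    then show "section_norm2 X (dirichlet_prod D0 x) \<le> section_norm2 X x" for X x
      using Hinf_multiplier_bound[OF assms, of 1 x X] by (simp add: section_norm2_def)
  qed (use iii in blast)
  show ?thesis using i_ii ii_iii iii_i frame_of_orbits_infinite by blast
qed

end
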